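(* Let $n\ge2$, $A_1,\dots,A_d\in\mathfrak{su}(n)$, and $\mathrm S_1\subseteq\{B_{ij}\}$, $\mathrm S_2\subseteq\{C_{ij}\}$, $\mathrm S_3\subseteq\{D_{ij}\}$ (all with $1\le i<j\le n$). Let $\mathscr G_{\rm drift}$ and $\mathscr G_{\rm contr}$ be the edge-colored multigraphs defined in the context, and suppose $\mathscr G_{\rm contr}$ is not connected. Then the system $\dot X=\mathsf B_0X+(\sum_{i=1}^m u_i\mathsf B_i)X$ is structurally controllable on $\mathrm{SU}(n)$ with respect to the pair of zero patterns $\big(\Sigma_{\rm r}(\{A_1,\dots,A_d\}),\Sigma_{\rm f}(\mathrm S_1\cup\mathrm S_2\cup\mathrm S_3)\big)$ if the following hold: (i) each connected component of $\mathscr G_{\rm contr}$ contains at least three nodes; (ii) $\mathscr G_{\rm drift}$ has no multi-edges and the union $\mathscr G_{\rm drift}\cup\mathscr G_{\rm contr}$ is connected; (iii) $\mathscr G_{\rm drift}\cup\mathscr G_{\rm contr}$ has a self-loop or a cycle containing an odd number of Red edges.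
   Context: $E_{ij}$ is the $n\times n$ matrix unit; $B_{ij}=E_{ij}-E_{ji}$, $C_{ij}=\mathrm i(E_{ij}+E_{ji})$, $D_{ij}=\mathrm i(E_{ii}-E_{jj})$. $\mathfrak{su}(n)$ (traceless skew-Hermitian matrices, a real Lie algebra) is the Lie algebra of $\mathrm{SU}(n)$. For a finite subset $\{g_s\}$ of a real Lie algebra, $\Sigma_{\rm f}(\{g_s\})=\{\sum l_sg_s:l_s\in\mathbb R\}$, $\Sigma_{\rm r}(\{g_s\})=\{\sum l_sg_s:l_s\in\mathbb R,l_s\ne0\ \forall s\}$. An edge-colored multigraph on $\mathrm V=\{1,\dots,n\}$ has edges $\{i,j;c\}$, $c\in\{\text{Blue},\text{Red},\text{Green}\}$; $\{i,i;c\}$ is a self-loop; a multi-edge is a collection of two or more edges (of different colors) with identical endpoints. $\mathscr G_{\rm drift}$ has: a Blue edge $\{i,j\}$ ($i\ne j$) iff $\mathrm{Re}([A_s]_{ij})=-\mathrm{Re}([A_s]_{ji})\ne0$ for some $s$; a Red edge $\{i,j\}$ ($i\ne j$) iff $\mathrm{Im}([A_s]_{ij})=\mathrm{Im}([A_s]_{ji})\ne0$ for some $s$; a Green self-loop $\{i,i\}$ iff $[A_s]_{ii}\ne0$ for some $s$. $\mathscr G_{\rm contr}$ has a Blue edge $\{i,j\}$ for each $B_{ij}\in\mathrm S_1$, a Red edge $\{i,j\}$ for each $C_{ij}\in\mathrm S_2$, and Green self-loops $\{i,i\},\{j,j\}$ for each $D_{ij}\in\mathrm S_3$. The union has node set $\mathrm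 V$ and the union of edge sets. A walk alternates nodes and edges with consecutive endpoints; a cycle is a closed walk; connected means any two nodes are joined by a walk; connected components are maximal connected subgraphs. For $\dot X=\mathsf B_0X+(\sum_{i=1}^m u_i\mathsf B_i)X$ on $\mathrm{SU}(n)$ (piecewise continuous real controls), controllable means every element of $\mathrm{SU}(n)$ is reachable from $X(0)=I$ at some time $T\ge0$; structurally controllable w.r.t. $(\Sigma_{\rm r}(\mathfrak g_\alpha),\Sigma_{\rm f}(\mathfrak g_\beta))$ means there exist $m\ge1$, $\mathsf B_0\in\Sigma_{\rm r}(\mathfrak g_\alpha)$, $\mathsf B_1,\dots,\mathsf B_m\in\Sigma_{\rm f}(\mathfrak g_\beta)$ making it controllable. *)

theory Defs
  imports "HOL-Analysis.Analysis"
begin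

type_synonym 'n cmat = "complex^'n^'n"

section \<open>Matrices\<close>

definition Emat :: "'n::finite \<Rightarrow> 'n \<Rightarrow> 'n cmat" where
  "Emat i j = (\<chi> k l. if k = i \<and> l = j then 1 else 0)"

definition Bmat :: "'n::finite \<Rightarrow> 'n \<Rightarrow> 'n cmat" where
  "Bmat i j = (\<chi> k l. Emat i j $ k $ l - Emat j i $ k $ l)"

definition Cmat :: "'n::finite \<Rightarrow> 'n \<Rightarrow> 'n cmat" where
  "Cmat i j = (\<chi> k l. \<i> * (Emat i j $ k $ l + Emat j i $ k $ l))"

definition Dmat :: "'n::finite \<Rightarrow> 'n \<Rightarrow> 'n cmat" where
  "Dmat i j = (\<chi> k l. \<i> * (Emat i i $ k $ l - Emat j j $ k $ l))"

definition adjoint_mat :: "'n::finite cmat \<Rightarrow> 'n cmat" where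
  "adjoint_mat A = (\<chi> k l. cnj (A $ l $ k))"

definition mtrace :: "'n::finite cmat \<Rightarrow> complex" where
  "mtrace A = (\<Sum>k\<in>UNIV. A $ k $ k)"

text \<open>su(n): traceless skew-Hermitian matrices\<close>
definition su :: "'n::finite cmat set" where
  "su = {A. adjoint_mat A = - A \<and> mtrace A = 0}"

text \<open>SU(n): unitary matrices of determinant 1\<close>
definition SU :: "'n::finite cmat set" where
  "SU = {X. adjoint_mat X ** X = mat 1 \<and> det X = 1}"

section \<open>Zero patterns\<close>

definition Sigma_f :: "'n::finite cmat set \<Rightarrow> 'n cmat set" where
  "Sigma_f G = {(\<Sum>g\<in>G. l g *\<^sub>R g) | l. True}"

definition Sigma_r :: "'n::finite cmat set \<Rightarrow> 'n cmat set" where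
  "Sigma_r G = {(\<Sum>g\<in>G. l g *\<^sub>R g) | l. \<forall>g\<in>G. l g \<noteq> 0}"

section \<open>Edge-colored multigraphs on the node set UNIV\<close>

datatype color = Blue | Red | Green

text \<open>An edge is its set of endpoints (a singleton for a self-loop) together with its colour.\<close>
type_synonym 'n edge = "'n set \<times> color"

definition drift_edges :: "'n::finite cmat set \<Rightarrow> 'n edge set" where
  "drift_edges As =
     {({i, j}, Blue) | i j. i \<noteq> j \<and> (\<exists>A\<in>As. Re (A $ i $ j) = - Re (A $ j $ i) \<and> Re (A $ i $ j) \<noteq> 0)}
   \<union> {({i, j}, Red) | i j. i \<noteq> j \<and> (\<exists>A\<in>As. Im (A $ i $ j) = Im (A $ j $ i) \<and> Im (A $ i $ j) \<noteq> 0)}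
   \<union> {({i}, Green) | i. \<exists>A\<in>As. A $ i $ i \<noteq> 0}"

definition contr_edges ::
  "'n::{finite,linorder} cmat set \<Rightarrow> 'n cmat set \<Rightarrow> 'n cmat set \<Rightarrow> 'n edge set" where
  "contr_edges S1 S2 S3 =
     {({i, j}, Blue) | i j. i < j \<and> Bmat i j \<in> S1}
   \<union> {({i, j}, Red) | i j. i < j \<and> Cmat i j \<in> S2}
   \<union> {({i}, Green) | i j. i < j \<and> Dmat i j \<in> S3}
   \<union> {({j}, Green) | i j. i < j \<and> Dmat i j \<in> S3}"

definition has_multi_edge :: "'n edge set \<Rightarrow> bool" where
  "has_multi_edge E \<longleftrightarrow> (\<exists>s c c'. c \<noteq> c' \<and> (s, c) \<in> E \<and> (s, c') \<in> E)"

definition has_self_loop :: "'n edge set \<Rightarrow> bool" where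
  "has_self_loop E \<longleftrightarrow> (\<exists>i c. ({i}, c) \<in> E)"

text \<open>A walk is a list of steps (u, e, v): edge e of E with endpoints u and v,
  consecutive steps sharing nodes.\<close>
definition is_walk :: "'n edge set \<Rightarrow> ('n \<times> 'n edge \<times> 'n) list \<Rightarrow> bool" where
  "is_walk E w \<longleftrightarrow>
     (\<forall>(u, e, v) \<in> set w. e \<in> E \<and> fst e = {u, v}) \<and>
     (\<forall>k. Suc k < length w \<longrightarrow> snd (snd (w ! k)) = fst (w ! Suc k))"

definition is_cycle :: "'n edge set \<Rightarrow> ('n \<times> 'n edge \<times> 'n) list \<Rightarrow> bool" where
  "is_cycle E w \<longleftrightarrow> is_walk E w \<and> w \<noteq> [] \<and> fst (hd w) = snd (snd (last w))"

definition num_red :: "('n \<times> 'n edge \<times> 'n) list \<Rightarrow> nat" where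
  "num_red w = length (filter (\<lambda>(u, e, v). snd e = Red) w)"

definition adj_rel :: "'n edge set \<Rightarrow> ('n \<times> 'n) set" where
  "adj_rel E = {(u, v). \<exists>c. ({u, v}, c) \<in> E}"

text \<open>Two nodes are joined by a walk iff they are related by the reflexive transitive closure.\<close>
definition graph_connected :: "'n edge set \<Rightarrow> bool" where
  "graph_connected E \<longleftrightarrow> (\<forall>u v. (u, v) \<in> (adj_rel E)\<^sup>*)"

text \<open>Node sets of the connected components.\<close>
definition components :: "'n edge set \<Rightarrow> 'n set set" where
  "components E = {{v. (u, v) \<in> (adj_rel E)\<^sup>*} | u. True}"

section \<open>Control system on SU(n)\<close>

definition piecewise_continuous_on :: "real \<Rightarrow> real \<Rightarrow> (real \<Rightarrow> real) \<Rightarrow> bool" where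
  "piecewise_continuous_on a b u \<longleftrightarrow>
     (\<exists>D. finite D \<and> D \<subseteq> {a..b} \<and> continuous_on ({a..b} - D) u \<and>
        (\<forall>d\<in>D. (d > a \<longrightarrow> (\<exists>l. (u \<longlongrightarrow> l) (at_left d))) \<and>
                (d < b \<longrightarrow> (\<exists>l. (u \<longlongrightarrow> l) (at_right d)))))"

text \<open>X solves dX/dt = B0 X + (sum_i u_i B_i) X on [0,T] with X(0) = I
  (continuous, satisfying the ODE except at finitely many times).\<close>
definition is_solution ::
  "'n::finite cmat \<Rightarrow> 'n cmat list \<Rightarrow> (nat \<Rightarrow> real \<Rightarrow> real) \<Rightarrow> real \<Rightarrow> (real \<Rightarrow> 'n cmat) \<Rightarrow> bool" where
  "is_solution B0 Bs u T X \<longleftrightarrow>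
     X 0 = mat 1 \<and> continuous_on {0..T} X \<and>
     (\<exists>S. finite S \<and> (\<forall>t\<in>{0..T} - S.
        (X has_vector_derivative
           ((B0 + (\<Sum>i<length Bs. u i t *\<^sub>R Bs ! i)) ** X t)) (at t within {0..T})))"

definition reachable_at :: "'n::finite cmat \<Rightarrow> 'n cmat list \<Rightarrow> real \<Rightarrow> 'n cmat \<Rightarrow> bool" where
  "reachable_at B0 Bs T Y \<longleftrightarrow>
     (\<exists>u X. (\<forall>i<length Bs. piecewise_continuous_on 0 T (u i)) \<and>
            is_solution B0 Bs u T X \<and> X T = Y)"

text \<open>Controls u_1..u_m are u 0 .. u (m-1); B_1..B_m are Bs!0 .. Bs!(m-1).\<close>
definition controllable :: "'n::finite cmat \<Rightarrow> 'n cmat list \<Rightarrow> bool" where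
  "controllable B0 Bs \<longleftrightarrow> (\<forall>Y\<in>SU. \<exists>T\<ge>0. reachable_at B0 Bs T Y)"

definition structurally_controllable :: "'n::finite cmat set \<Rightarrow> 'n cmat set \<Rightarrow> bool" where
  "structurally_controllable Ga Gb \<longleftrightarrow>
     (\<exists>B0 Bs. length Bs \<ge> 1 \<and> B0 \<in> Sigma_r Ga \<and> set Bs \<subseteq> Sigma_f Gb \<and> controllable B0 Bs)"

end

theory Submission
  imports Defs
begin

text \<open>
  Every matrix exponential \<open>exp (t Z)\<close> with \<open>t \<ge> 0\<close> and \<open>Z = B0 + \<Sum> c_i B_i\<close> is reachable, so the
  reachable set contains the semigroup \<open>S\<close> generated by these exponentials. Its closure is a compact
  subsemigroup of \<open>SU(n)\<close>, hence a group, and the matrices \<open>Z\<close> with \<open>exp (t Z)\<close> in the closure for all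
  real \<open>t\<close> form a Lie algebra containing \<open>B0\<close> and the \<open>B_i\<close>. If \<open>B0\<close> and the \<open>B_i\<close> generate \<open>su(n)\<close>,
  then \<open>S\<close> is dense; moreover the conjugates \<open>s Z s*\<close> with \<open>s\<close> in \<open>S\<close> span \<open>su(n)\<close>, so a product of
  exponentials with suitable switches has a surjective differential and \<open>S\<close> has interior points in
  \<open>SU(n)\<close>. A dense subsemigroup with interior points is everything.

  For the generation, a drift with generic coefficients has a nonzero entry at every drift edge. Three
  nodes per control component allow iterated brackets with control elements to isolate the entries
  of the drift between different components; as the drift has no multi-edges, each isolated entry
  yields \<open>B_ij\<close> or \<open>C_ij\<close>, and by connectedness one of the two lies in the Lie algebra for each pair
  \<open>i, j\<close>. If never both do, then the colours form a cocycle, so every cycle has an even number of red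
  edges and all diagonal entries vanish. Otherwise the Lie algebra is \<open>su(n)\<close>.
\<close>

text \<open>The drift cannot be switched off and time runs only forward. A dense semigroup may be
  proper, so interior points are unavoidable. \<open>SU\<close> has empty interior among all
  matrices. The semigroup-valued map is therefore completed by a linear term orthogonal to
  \<open>su\<close>, an open mapping theorem is applied in the whole matrix space, and the added
  term is shown to vanish whenever the value lies in \<open>SU\<close>. Surjectivity of the
  exponential on \<open>SU\<close> is bypassed: embedded copies of SU(2), where the exponential is
  explicit, generate the group by Givens elimination. Three nodes matter because the double bracket
  with a unit on \<open>{a, b}\<close> treats rows \<open>a\<close> and \<open>b\<close> alike. A
  second pair \<open>{a, c}\<close> singles out index \<open>a\<close>, and the same in the other
  component singles out one entry. Double brackets are used because they act alike for B and C links
  and, up to sign, keep the selected entries unchanged. The case distinction at the end rests on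
  propagation: a single pair carrying both units spreads to all pairs by brackets.\<close>

lemma bounded_bilinear_matrix_mult:
  "bounded_bilinear ((**) :: 'n::finite cmat \<Rightarrow> 'n cmat \<Rightarrow> 'n cmat)"
  unfolding bilinear_conv_bounded_bilinear[symmetric] bilinear_def
  by (auto intro!: linearI simp: vec_eq_iff matrix_matrix_mult_def algebra_simps
      sum.distrib scaleR_sum_right)

interpretation mm: bounded_bilinear "(**) :: 'n::finite cmat \<Rightarrow> 'n cmat \<Rightarrow> 'n cmat"
  by (rule bounded_bilinear_matrix_mult)

lemma matrix_mult_left_add:
  "(**) (A + B) = (\<lambda>X::'n cmat. A ** X + B ** X)" for A B :: "'n::finite cmat"
  by (simp add: fun_eq_iff mm.add_left)

lemma matrix_mult_left_scaleR:
  "(**) (r *\<^sub>R A) = (\<lambda>X::'n cmat. r *\<^sub>R (A ** X))" for A :: "'n::finite cmat"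
  by (simp add: fun_eq_iff mm.scaleR_left)

lemma mat_one_nonzero: "(mat 1 :: 'n::finite cmat) \<noteq> 0"
  by (auto simp: vec_eq_iff mat_def)

section \<open>The matrix exponential\<close>

text \<open>The library multiplies elements of type \<^typ>\<open>'n cmat\<close> entrywise; a copy of the type
  that carries the matrix product and the operator norm of left multiplication is a Banach
  algebra, so that the generic exponential applies.\<close>

typedef 'n matalg = "UNIV :: 'n::finite cmat set"
  morphisms mat_of alg_of ..

setup_lifting type_definition_matalg

instantiation matalg :: (finite) real_normed_algebra_1
begin

lift_definition zero_matalg :: "'a matalg" is 0 .
lift_definition one_matalg :: "'a matalg" is "mat 1" .
lift_definition plus_matalg :: "'a matalg \<Rightarrow> 'a matalg \<Rightarrow> 'a matalg" is "(+)" .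
lift_definition minus_matalg :: "'a matalg \<Rightarrow> 'a matalg \<Rightarrow> 'a matalg" is "(-)" .
lift_definition uminus_matalg :: "'a matalg \<Rightarrow> 'a matalg" is uminus .
lift_definition times_matalg :: "'a matalg \<Rightarrow> 'a matalg \<Rightarrow> 'a matalg" is "(**)" .
lift_definition scaleR_matalg :: "real \<Rightarrow> 'a matalg \<Rightarrow> 'a matalg" is "(*\<^sub>R)" .
lift_definition norm_matalg :: "'a matalg \<Rightarrow> real" is "\<lambda>A. onorm (\<lambda>B::'a cmat. A ** B)" .
definition dist_matalg :: "'a matalg \<Rightarrow> 'a matalg \<Rightarrow> real" where
  "dist_matalg a b = norm (a - b)"
definition uniformity_matalg :: "('a matalg \<times> 'a matalg) filter" where
  "uniformity_matalg = (INF e\<in>{0 <..}. principal {(x, y). dist x y < e})"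
definition open_matalg :: "'a matalg set \<Rightarrow> bool" where
  "open_matalg S = (\<forall>x\<in>S. \<forall>\<^sub>F (x', y) in uniformity. x' = x \<longrightarrow> y \<in> S)"
definition sgn_matalg :: "'a matalg \<Rightarrow> 'a matalg" where
  "sgn_matalg x = scaleR (inverse (norm x)) x"

instance
proof
  fix a b c :: "'a matalg" and r s :: real and U :: "'a matalg set"
  note bl = mm.bounded_linear_right
  show "norm (a * b) \<le> norm a * norm b"
    by transfer (use onorm_compose[OF bl bl] in \<open>simp add: o_def matrix_mul_assoc\<close>)
  show "norm (1 :: 'a matalg) = 1"
    by transfer (simp add: onorm_id)
  show "norm (a + b) \<le> norm a + norm b"
    by transfer (simp add: onorm_triangle[OF bl bl] matrix_mult_left_add)
  show "norm (r *\<^sub>R a) = \<bar>r\<bar> * norm a"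
    by transfer (simp add: onorm_scaleR[OF bl] matrix_mult_left_scaleR)
  show "(norm a = 0) = (a = 0)"
  proof transfer
    fix A :: "'a cmat"
    have "A ** mat 1 = A" by simp
    then show "(onorm (\<lambda>B::'a cmat. A ** B) = 0) = (A = 0)"
      unfolding onorm_eq_0[OF bl] by (metis mm.zero_left)
  qed
  show "(0::'a matalg) \<noteq> 1"
    by transfer (metis mat_one_nonzero)
qed (unfold dist_matalg_def open_matalg_def sgn_matalg_def uniformity_matalg_def,
    (rule refl | (transfer, simp add: matrix_mul_assoc mm.add_left mm.add_right
      mm.scaleR_left mm.scaleR_right scaleR_add_left scaleR_add_right)
     )+)

end

lemma bounded_linear_mat_of: "bounded_linear (mat_of :: 'n::finite matalg \<Rightarrow> 'n cmat)"
proof (rule bounded_linear_intro)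
  fix a b :: "'n matalg" and r :: real
  show "mat_of (a + b) = mat_of a + mat_of b" by transfer simp
  show "mat_of (r *\<^sub>R a) = r *\<^sub>R mat_of a" by transfer simp
  show "norm (mat_of a) \<le> norm a * norm (mat 1 :: 'n cmat)"
    by transfer (metis onorm[OF mm.bounded_linear_right] matrix_mul_rid)
qed

lemma bounded_linear_alg_of: "bounded_linear (alg_of :: 'n::finite cmat \<Rightarrow> 'n matalg)"
proof -
  obtain K where K: "K > 0" "\<And>(A::'n cmat) (B::'n cmat). norm (A ** B) \<le> norm A * norm B * K"
    using mm.pos_bounded by blast
  show ?thesis
  proof (rule bounded_linear_intro)
    fix a b :: "'n cmat" and r :: real
    show "alg_of (a + b) = alg_of a + alg_of b" by (simp add: plus_matalg.abs_eq)
    show "alg_of (r *\<^sub>R a) = r *\<^sub>R alg_of a" by (simp add: scaleR_matalg.abs_eq)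
    show "norm (alg_of a) \<le> norm a * K"
      unfolding norm_matalg.abs_eq by (rule onorm_le) (metis K(2) mult.assoc mult.commute)
  qed
qed

instance matalg :: (finite) banach
proof
  fix X :: "nat \<Rightarrow> 'a matalg"
  assume "Cauchy X"
  then have "Cauchy (\<lambda>n. mat_of (X n))"
    by (rule bounded_linear.Cauchy[OF bounded_linear_mat_of])
  then obtain L where "(\<lambda>n. mat_of (X n)) \<longlonglongrightarrow> L"
    using Cauchy_convergent_iff convergent_def by blast
  then have "(\<lambda>n. alg_of (mat_of (X n))) \<longlonglongrightarrow> alg_of L"
    by (rule bounded_linear.tendsto[OF bounded_linear_alg_of])
  then show "convergent X"
    by (auto simp: mat_of_inverse convergent_def)
qed

section \<open>The matrix exponential, characterised by its differential equation\<close>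

definition mexp :: "'n::finite cmat \<Rightarrow> 'n cmat" where
  "mexp A = mat_of (exp (alg_of A))"

lemma mexp_zero [simp]: "mexp 0 = mat 1"
  using one_matalg.rep_eq by (simp add: mexp_def flip: zero_matalg_def)

lemma mexp_has_vector_derivative:
  "((\<lambda>t. mexp (t *\<^sub>R A)) has_vector_derivative A ** mexp (t *\<^sub>R A)) (at t within S)"
proof -
  have "((\<lambda>t. mat_of (exp (t *\<^sub>R alg_of A))) has_vector_derivative
      mat_of (alg_of A * exp (t *\<^sub>R alg_of A))) (at t)"
    by (intro bounded_linear.has_vector_derivative[OF bounded_linear_mat_of]
        exp_scaleR_has_vector_derivative_left)
  then show ?thesis
    by (simp add: mexp_def scaleR_matalg.abs_eq times_matalg.rep_eq alg_of_inverse
        has_vector_derivative_at_within)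
qed

lemma mexp_minus_left_inverse: "mexp (- A) ** mexp A = mat 1"
proof -
  have "mat_of (exp (- alg_of A) * exp (alg_of A)) = mat 1"
    by (metis exp_minus_inverse minus_minus one_matalg.rep_eq)
  then show ?thesis
    by (simp add: mexp_def times_matalg.rep_eq uminus_matalg.abs_eq)
qed

lemma mexp_minus_right_inverse: "mexp A ** mexp (- A) = mat 1"
  using mexp_minus_left_inverse[of "- A"] by simp

lemma mexp_commute: "A ** mexp A = mexp A ** A"
proof -
  have "mat_of (alg_of A * exp (alg_of A)) = mat_of (exp (alg_of A) * alg_of A)"
    by (metis exp_times_scaleR_commute scaleR_one)
  then show ?thesis
    by (simp add: mexp_def times_matalg.rep_eq alg_of_inverse)
qed

text \<open>The product of \<open>mexp (t *\<^sub>R (- A))\<close> and \<open>R t\<close> has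
  derivative zero. Closed forms of exponentials, such as conjugates and plane rotations, can thus be
  verified by differentiation instead of power series.\<close>

lemma mexp_unique:
  assumes "\<And>t. (R has_vector_derivative A ** R t) (at t)" and "R 0 = mat 1"
  shows "R t = mexp (t *\<^sub>R A)"
proof -
  have d: "((\<lambda>t. mexp (t *\<^sub>R (- A)) ** R t) has_vector_derivative 0) (at t)" for t
  proof -
    have "((\<lambda>t. mexp (t *\<^sub>R (- A)) ** R t) has_vector_derivative
        (mexp (t *\<^sub>R (- A)) ** (A ** R t) + ((- A) ** mexp (t *\<^sub>R (- A))) ** R t)) (at t)"
      by (intro mm.has_vector_derivative mexp_has_vector_derivative assms)
    moreover have "A ** mexp (t *\<^sub>R (- A)) = mexp (t *\<^sub>R (- A)) ** A"
    proof (cases "t = 0")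
      case False
      have "t *\<^sub>R (- (A ** mexp (t *\<^sub>R (- A)))) = t *\<^sub>R (- (mexp (t *\<^sub>R (- A)) ** A))"
        using mexp_commute[of "t *\<^sub>R (- A)"]
        by (simp add: mm.minus_left mm.minus_right mm.scaleR_left mm.scaleR_right)
      then show ?thesis using False by simp
    qed simp
    ultimately show ?thesis by (simp add: matrix_mul_assoc mm.minus_left)
  qed
  obtain c where c: "\<And>t. mexp (t *\<^sub>R (- A)) ** R t = c"
    using has_vector_derivative_zero_constant[OF convex_UNIV, of "\<lambda>t. mexp (t *\<^sub>R (- A)) ** R t"] d
    by auto
  have "mexp (t *\<^sub>R (- A)) ** R t = mat 1"
    using c[of t] c[of 0] assms(2) by simp
  then have "mexp (t *\<^sub>R A) ** (mexp (- (t *\<^sub>R A)) ** R t) = mexp (t *\<^sub>R A)"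
    by simp
  then show ?thesis
    by (simp add: matrix_mul_assoc mexp_minus_right_inverse)
qed

lemma mexp_add_scaleR: "mexp ((s + t) *\<^sub>R A) = mexp (s *\<^sub>R A) ** mexp (t *\<^sub>R A)"
proof -
  have "((\<lambda>s. mexp ((s + t) *\<^sub>R A) ** mexp (- (t *\<^sub>R A))) has_vector_derivative
      A ** (mexp ((s + t) *\<^sub>R A) ** mexp (- (t *\<^sub>R A)))) (at s)" for s
  proof -
    have "((\<lambda>s. s + t) has_vector_derivative 1) (at s)"
      unfolding has_real_derivative_iff_has_vector_derivative[symmetric]
      by (auto intro!: derivative_eq_intros)
    from vector_diff_chain_at[OF this mexp_has_vector_derivative[of A]]
    have "((\<lambda>s. mexp ((s + t) *\<^sub>R A)) has_vector_derivative A ** mexp ((s + t) *\<^sub>R A)) (at s)"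
      by (simp add: o_def)
    from bounded_linear.has_vector_derivative[OF mm.bounded_linear_left this]
    show ?thesis by (simp add: matrix_mul_assoc)
  qed
  then have "mexp ((s + t) *\<^sub>R A) ** mexp (- (t *\<^sub>R A)) = mexp (s *\<^sub>R A)"
    using mexp_unique[where R = "\<lambda>s. mexp ((s + t) *\<^sub>R A) ** mexp (- (t *\<^sub>R A))" and t = s]
    by (simp add: mexp_minus_right_inverse)
  then have "mexp (s *\<^sub>R A) ** mexp (t *\<^sub>R A)
      = mexp ((s + t) *\<^sub>R A) ** (mexp (- (t *\<^sub>R A)) ** mexp (t *\<^sub>R A))"
    by (simp add: matrix_mul_assoc)
  then show ?thesis by (simp add: mexp_minus_left_inverse)
qed

lemma mexp_conj:
  fixes U V :: "'n::finite cmat"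
  assumes "U ** V = mat 1"
  shows "U ** mexp (t *\<^sub>R A) ** V = mexp (t *\<^sub>R (U ** A ** V))"
proof (rule mexp_unique)
  have V: "V ** U = mat 1" using assms by (metis matrix_left_right_inverse)
  fix t
  have "((\<lambda>t. U ** mexp (t *\<^sub>R A) ** V) has_vector_derivative (U ** (A ** mexp (t *\<^sub>R A)) ** V)) (at t)"
    by (intro bounded_linear.has_vector_derivative[OF mm.bounded_linear_left]
        bounded_linear.has_vector_derivative[OF mm.bounded_linear_right] mexp_has_vector_derivative)
  moreover have "U ** A ** V ** (U ** mexp (t *\<^sub>R A) ** V) = U ** A ** (V ** U) ** mexp (t *\<^sub>R A) ** V"
    by (simp only: matrix_mul_assoc)
  ultimately show "((\<lambda>t. U ** mexp (t *\<^sub>R A) ** V) has_vector_derivative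
      U ** A ** V ** (U ** mexp (t *\<^sub>R A) ** V)) (at t)"
    by (simp add: V matrix_mul_assoc)
qed (simp add: assms)

lemma continuous_on_mexp: "continuous_on S (\<lambda>t. mexp (t *\<^sub>R A))"
  by (rule continuous_on_vector_derivative) (rule mexp_has_vector_derivative)

section \<open>Unitary matrices\<close>

lemma adjoint_mat_mult: "adjoint_mat (A ** B) = adjoint_mat B ** adjoint_mat A"
  by (simp add: adjoint_mat_def matrix_matrix_mult_def vec_eq_iff mult.commute)

lemma adjoint_mat_adjoint_mat [simp]: "adjoint_mat (adjoint_mat A) = A"
  by (simp add: adjoint_mat_def vec_eq_iff)

lemma adjoint_mat_one [simp]: "adjoint_mat (mat 1) = mat 1"
  by (simp add: adjoint_mat_def mat_def vec_eq_iff)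

lemma bounded_linear_adjoint_mat: "bounded_linear adjoint_mat"
  unfolding linear_conv_bounded_linear[symmetric]
  by (auto intro!: linearI simp: adjoint_mat_def vec_eq_iff)

lemmas adjoint_mat_add = linear_add[OF bounded_linear.linear[OF bounded_linear_adjoint_mat]]
  and adjoint_mat_scaleR = linear_scale[OF bounded_linear.linear[OF bounded_linear_adjoint_mat]]
  and adjoint_mat_diff = linear_diff[OF bounded_linear.linear[OF bounded_linear_adjoint_mat]]
  and adjoint_mat_zero = linear_0[OF bounded_linear.linear[OF bounded_linear_adjoint_mat]]

lemma bounded_linear_mtrace: "bounded_linear mtrace"
  unfolding linear_conv_bounded_linear[symmetric]
  by (auto intro!: linearI simp: mtrace_def sum.distrib scaleR_sum_right)

lemmas mtrace_add = linear_add[OF bounded_linear.linear[OF bounded_linear_mtrace]]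
  and mtrace_scaleR = linear_scale[OF bounded_linear.linear[OF bounded_linear_mtrace]]
  and mtrace_diff = linear_diff[OF bounded_linear.linear[OF bounded_linear_mtrace]]
  and mtrace_zero = linear_0[OF bounded_linear.linear[OF bounded_linear_mtrace]]

lemma mtrace_mult_commute: "mtrace (A ** B) = mtrace (B ** A)"
  for A B :: "'n::finite cmat"
  unfolding mtrace_def matrix_matrix_mult_def vec_lambda_beta
  by (subst sum.swap) (simp add: mult.commute)

text \<open>The Euclidean inner product of the library is the real Hilbert-Schmidt product, so
  multiplication by a unitary matrix on either side is an isometry. Many later estimates depend on
  this.\<close>

lemma inner_cmat: "A \<bullet> B = Re (mtrace (adjoint_mat A ** B))" for A :: "'n::finite cmat"
proof -
  have "A \<bullet> B = (\<Sum>i\<in>UNIV. \<Sum>j\<in>UNIV. Re (cnj (A $ i $ j) * B $ i $ j))"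
    by (simp add: inner_vec_def inner_complex_def)
  also have "\<dots> = (\<Sum>j\<in>UNIV. \<Sum>i\<in>UNIV. Re (cnj (A $ i $ j) * B $ i $ j))"
    by (rule sum.swap)
  finally show ?thesis
    by (simp add: mtrace_def matrix_matrix_mult_def adjoint_mat_def Re_sum)
qed

lemma SU_adjoint_left: "X \<in> SU \<Longrightarrow> adjoint_mat X ** X = mat 1"
  by (simp add: SU_def)

lemma SU_adjoint_right: "X \<in> SU \<Longrightarrow> X ** adjoint_mat X = mat 1"
  by (metis SU_adjoint_left matrix_left_right_inverse)

lemma det_adjoint_mat: "det (adjoint_mat A) = cnj (det A)"
proof -
  have "adjoint_mat A = transpose (\<chi> i j. cnj (A $ i $ j))"
    by (simp add: adjoint_mat_def transpose_def)
  then show ?thesis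
    by (simp add: det_transpose) (simp add: det_def)
qed

lemma SU_one [simp]: "mat 1 \<in> SU"
  by (simp add: SU_def)

lemma SU_mult: "X \<in> SU \<Longrightarrow> Y \<in> SU \<Longrightarrow> X ** Y \<in> SU"
  unfolding SU_def mem_Collect_eq adjoint_mat_mult det_mul
  by (metis (no_types) matrix_mul_assoc matrix_mul_rid mult_1)

lemma SU_adjoint: "X \<in> SU \<Longrightarrow> adjoint_mat X \<in> SU"
  using SU_adjoint_right by (auto simp: SU_def det_adjoint_mat)

lemma norm_SU_mult_left:
  fixes U A :: "'n::finite cmat"
  assumes "U \<in> SU" shows "norm (U ** A) = norm A"
proof -
  have "adjoint_mat (U ** A) ** (U ** A) = adjoint_mat A ** (adjoint_mat U ** U) ** A"
    by (simp add: adjoint_mat_mult matrix_mul_assoc)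
  then show ?thesis
    using assms by (simp add: norm_eq_sqrt_inner inner_cmat SU_adjoint_left)
qed

lemma norm_adjoint_mat [simp]: "norm (adjoint_mat A) = norm A"
  unfolding norm_eq_sqrt_inner inner_cmat adjoint_mat_adjoint_mat
  by (subst mtrace_mult_commute) (rule refl)

lemma norm_SU_mult_right:
  fixes U A :: "'n::finite cmat"
  assumes "U \<in> SU" shows "norm (A ** U) = norm A"
  by (metis SU_adjoint adjoint_mat_mult assms norm_SU_mult_left norm_adjoint_mat)

lemma norm_SU: "U \<in> SU \<Longrightarrow> norm U = norm (mat 1 :: 'n cmat)" for U :: "'n::finite cmat"
  by (metis matrix_mul_rid norm_SU_mult_left)

lemma continuous_on_det: "continuous_on S (det :: 'n::finite cmat \<Rightarrow> complex)"
  unfolding det_def by (intro continuous_intros)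

lemma closed_SU: "closed (SU :: 'n::finite cmat set)"
proof -
  have "closed {X :: 'n cmat. adjoint_mat X ** X = mat 1}"
    by (intro closed_Collect_eq mm.continuous_on continuous_on_const continuous_on_id
        bounded_linear.continuous_on[OF bounded_linear_adjoint_mat])
  moreover have "closed {X :: 'n cmat. det X = 1}"
    by (intro closed_Collect_eq continuous_on_const continuous_on_det)
  ultimately show ?thesis
    unfolding SU_def by (rule closed_Collect_conj)
qed

lemma compact_SU: "compact (SU :: 'n::finite cmat set)"
  unfolding compact_eq_bounded_closed bounded_iff
  using closed_SU norm_SU by (metis order_refl)

text \<open>Jacobi's formula at the identity. It yields determinant 1 for exponentials of traceless
  matrices, and later shows that the trace of \<open>k - mat 1\<close> is negligible against its
  norm for \<open>k\<close> in \<open>SU\<close> near the identity.\<close>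

lemma has_derivative_det_one:
  "((det :: 'n::finite cmat \<Rightarrow> complex) has_derivative mtrace) (at (mat 1))"
proof -
  let ?P = "{p. p permutes (UNIV :: 'n set)}"
  let ?I = "mat 1 :: 'n cmat"
  let ?D = "\<lambda>p (H :: 'n cmat). \<Sum>i\<in>UNIV. H $ i $ p i * (\<Prod>j\<in>UNIV - {i}. ?I $ j $ p j)"
  have "((\<lambda>A :: 'n cmat. \<Sum>p\<in>?P. of_int (sign p) * (\<Prod>i\<in>UNIV. A $ i $ p i)) has_derivative
      (\<lambda>H. \<Sum>p\<in>?P. of_int (sign p) * ?D p H)) (at ?I)"
    by (intro has_derivative_sum has_derivative_mult_right has_derivative_prod
        bounded_linear_imp_has_derivative bounded_linear_compose[OF bounded_linear_vec_nth]
        bounded_linear_vec_nth)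
  moreover have "(\<Sum>p\<in>?P. of_int (sign p) * ?D p H) = mtrace H" for H
  proof -
    \<comment> \<open>A permutation other than \<open>id\<close> moves at least two points, so a
      zero off-diagonal entry of the identity remains after the factor at \<open>i\<close> is
      removed.\<close>
    have "?D p H = 0" if p: "p permutes UNIV" "p \<noteq> id" for p
    proof (rule sum.neutral, rule ballI)
      fix i :: 'n
      have "\<exists>j. j \<noteq> i \<and> p j \<noteq> j"
      proof (rule ccontr)
        assume "\<not> ?thesis"
        then have *: "p j = j" if "j \<noteq> i" for j using that by blast
        moreover have "p i = i"
        proof (rule ccontr)
          assume "p i \<noteq> i"
          then have "p (p i) = p i" using * by simp
          then show False using \<open>p i \<noteq> i\<close> permutes_inj[OF p(1)] by (simp add: inj_eq)
        qed
        ultimately have "p = id" by (metis eq_id_iff)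
        then show False using p by simp
      qed
      then obtain j where "j \<noteq> i" "p j \<noteq> j" by blast
      then have "(\<Prod>j\<in>UNIV - {i}. ?I $ j $ p j) = 0"
        by (intro prod_zero bexI[of _ j]) (auto simp: mat_def)
      then show "H $ i $ p i * (\<Prod>j\<in>UNIV - {i}. ?I $ j $ p j) = 0" by simp
    qed
    then have "(\<Sum>p\<in>?P. of_int (sign p) * ?D p H) = (\<Sum>p\<in>{id}. of_int (sign p) * ?D p H)"
      by (intro sum.mono_neutral_right) (auto simp: permutes_id finite_permutations)
    also have "\<dots> = mtrace H"
      by (simp add: mtrace_def mat_def sign_id)
    finally show ?thesis .
  qed
  ultimately show ?thesis
    by (simp add: det_def[abs_def])
qed

lemma mexp_in_SU:
  assumes "A \<in> su" shows "mexp A \<in> SU"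
proof -
  define E where "E t = mexp (t *\<^sub>R A)" for t
  have A: "adjoint_mat A = - A" "mtrace A = 0" using assms by (auto simp: su_def)
  have E': "(E has_vector_derivative A ** E t) (at t)" for t
    unfolding E_def by (rule mexp_has_vector_derivative)
  have E0: "E 0 = mat 1" by (simp add: E_def)
  have "((\<lambda>t. adjoint_mat (E t) ** E t) has_vector_derivative 0) (at t)" for t
  proof -
    have "((\<lambda>t. adjoint_mat (E t) ** E t) has_vector_derivative
       (adjoint_mat (E t) ** (A ** E t) + adjoint_mat (A ** E t) ** E t)) (at t)"
      by (intro mm.has_vector_derivative bounded_linear.has_vector_derivative[OF bounded_linear_adjoint_mat] E')
    then show ?thesis
      by (simp add: adjoint_mat_mult A matrix_mul_assoc mm.minus_right mm.minus_left)
  qed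
  then obtain c where c: "\<And>t. adjoint_mat (E t) ** E t = c"
    using has_vector_derivative_zero_constant[OF convex_UNIV, of "\<lambda>t. adjoint_mat (E t) ** E t"]
    by auto
  have d0: "((\<lambda>h. det (E h)) has_vector_derivative 0) (at 0)"
    using has_derivative_compose[of E "\<lambda>h. h *\<^sub>R (A ** E 0)" 0 UNIV det mtrace]
      E'[of 0] has_derivative_det_one
    by (simp add: E0 has_vector_derivative_def mtrace_scaleR A)
  \<comment> \<open>Jacobi's formula is available only at the identity;
    \<open>E s = E (s - t) ** E t\<close> carries the vanishing derivative from time 0 to time
    \<open>t\<close>.\<close>
  have "((\<lambda>t. det (E t)) has_vector_derivative 0) (at t)" for t
  proof -
    have "((\<lambda>h. det (E h) * det (E t)) has_vector_derivative 0 * det (E t)) (at (t - t))"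
      using d0 by (intro has_vector_derivative_mult_left) simp
    then have "(((\<lambda>h. det (E h) * det (E t)) \<circ> (\<lambda>s. s - t)) has_vector_derivative
        1 *\<^sub>R (0 * det (E t))) (at t)"
      by (intro vector_diff_chain_at)
        (auto intro!: derivative_eq_intros simp flip: has_real_derivative_iff_has_vector_derivative)
    moreover have "det (E (s - t)) * det (E t) = det (E s)" for s
      using mexp_add_scaleR[of "s - t" t A] by (simp add: E_def det_mul)
    ultimately show ?thesis by (simp add: o_def)
  qed
  then obtain d where d: "\<And>t. det (E t) = d"
    using has_vector_derivative_zero_constant[OF convex_UNIV, of "\<lambda>t. det (E t)"] by auto
  have "adjoint_mat (E 1) ** E 1 = mat 1" "det (E 1) = 1"
    using c[of 0] c[of 1] d[of 0] d[of 1] by (auto simp: E0)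
  then show ?thesis by (simp add: SU_def E_def)
qed

lemma subspace_su: "subspace su"
  unfolding subspace_def su_def
  by (auto simp: adjoint_mat_add adjoint_mat_scaleR mtrace_add mtrace_scaleR adjoint_mat_zero mtrace_zero)

lemma su_conj:
  assumes "U \<in> SU" "A \<in> su" shows "U ** A ** adjoint_mat U \<in> su"
proof -
  have "mtrace (U ** A ** adjoint_mat U) = mtrace (adjoint_mat U ** U ** A)"
    by (metis matrix_mul_assoc mtrace_mult_commute)
  then show ?thesis
    using assms
    by (simp add: su_def SU_adjoint_left adjoint_mat_mult matrix_mul_assoc mm.minus_right mm.minus_left)
qed

section \<open>Reachable elements\<close>

text \<open>Factors are added on the left, since a later piece of the motion multiplies the state
  from the left.\<close>

inductive_set exp_semigroup :: "'n::finite cmat set \<Rightarrow> 'n cmat set" for F where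
  one: "mat 1 \<in> exp_semigroup F"
| step: "Y \<in> exp_semigroup F \<Longrightarrow> Z \<in> F \<Longrightarrow> 0 \<le> t \<Longrightarrow> mexp (t *\<^sub>R Z) ** Y \<in> exp_semigroup F"

definition velocities :: "'n::finite cmat \<Rightarrow> 'n cmat list \<Rightarrow> 'n cmat set" where
  "velocities B0 Bs = {B0 + (\<Sum>i<length Bs. c i *\<^sub>R Bs ! i) | c :: nat \<Rightarrow> real. True}"

text \<open>A version of piecewise continuity on the whole line: without interval endpoints,
  concatenating controls requires no special treatment of boundary limits.\<close>

definition regulated :: "(real \<Rightarrow> real) \<Rightarrow> bool" where
  "regulated u \<longleftrightarrow> (\<exists>D. finite D \<and> (\<forall>t. t \<notin> D \<longrightarrow> isCont u t)) \<and>
     (\<forall>d. (\<exists>l. (u \<longlongrightarrow> l) (at_left d)) \<and> (\<exists>l. (u \<longlongrightarrow> l) (at_right d)))"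

lemma regulated_const: "regulated (\<lambda>t. c)"
  unfolding regulated_def by (auto intro!: exI[of _ "{}"] tendsto_const)

lemma regulated_append:
  assumes "regulated u"
  shows "regulated (\<lambda>t. if t \<le> T then u t else c)" (is "regulated ?v")
proof -
  obtain D where D: "finite D" "\<And>t. t \<notin> D \<Longrightarrow> isCont u t"
    and L: "\<And>d. \<exists>l. (u \<longlongrightarrow> l) (at_left d)" and R: "\<And>d. \<exists>l. (u \<longlongrightarrow> l) (at_right d)"
    using assms unfolding regulated_def by blast
  have lt: "\<forall>\<^sub>F s in nhds t. ?v s = u s" if "t < T" for t
    by (rule eventually_mono[OF eventually_nhds_in_open[of "{..<T}"]]) (use that in auto)
  have gt: "\<forall>\<^sub>F s in nhds t. ?v s = c" if "t > T" for t
    by (rule eventually_mono[OF eventually_nhds_in_open[of "{T<..}"]]) (use that in auto)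
  have "isCont ?v t" if "t \<notin> insert T D" for t
  proof (cases "t < T")
    case True
    then show ?thesis using D(2)[of t] that isCont_cong[OF lt[OF True]] by simp
  next
    case False
    then have "t > T" using that by auto
    then show ?thesis using isCont_cong[OF gt[OF \<open>t > T\<close>]] by simp
  qed
  moreover have "\<exists>l. (?v \<longlongrightarrow> l) (at_left d)" for d
  proof (cases "d \<le> T")
    case True
    have "\<forall>\<^sub>F s in at_left d. ?v s = u s"
      using True by (auto simp: eventually_at_filter)
    then show ?thesis using L[of d] by (simp only: tendsto_cong)
  next
    case False
    then have "\<forall>\<^sub>F s in at_left d. ?v s = c"
      unfolding eventually_at_filter by (intro eventually_mono[OF gt]) auto
    then show ?thesis by (intro exI[of _ c]) (simp only: tendsto_cong tendsto_const)
  qed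
  moreover have "\<exists>l. (?v \<longlongrightarrow> l) (at_right d)" for d
  proof (cases "d < T")
    case True
    have "\<forall>\<^sub>F s in at_right d. ?v s = u s"
      unfolding eventually_at_filter by (intro eventually_mono[OF lt[OF True]]) auto
    then show ?thesis using R[of d] by (simp only: tendsto_cong)
  next
    case False
    then have "\<forall>\<^sub>F s in at_right d. ?v s = c"
      by (auto simp: eventually_at_filter)
    then show ?thesis by (intro exI[of _ c]) (simp only: tendsto_cong tendsto_const)
  qed
  ultimately show ?thesis
    unfolding regulated_def using D(1) by (intro conjI exI[of _ "insert T D"]) auto
qed

lemma regulated_piecewise_continuous_on:
  assumes "regulated u" shows "piecewise_continuous_on a b u"
proof -
  obtain D where D: "finite D" "\<And>t. t \<notin> D \<Longrightarrow> isCont u t"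
    using assms unfolding regulated_def by blast
  have "continuous_on ({a..b} - D \<inter> {a..b}) u"
    using D(2) by (auto intro!: continuous_at_imp_continuous_on)
  then show ?thesis
    unfolding piecewise_continuous_on_def using D(1) assms
    by (intro exI[of _ "D \<inter> {a..b}"]) (auto simp: regulated_def)
qed

text \<open>Differentiability is two-sided and asked only inside the interval, so pieces can be
  glued by local agreement; the endpoints join the exceptional set when a solution is
  extracted.\<close>

definition trajectory ::
  "'n::finite cmat \<Rightarrow> 'n cmat list \<Rightarrow> (nat \<Rightarrow> real \<Rightarrow> real) \<Rightarrow> real \<Rightarrow> (real \<Rightarrow> 'n cmat) \<Rightarrow> bool" where
  "trajectory B0 Bs u T X \<longleftrightarrow> 0 \<le> T \<and> (\<forall>i. regulated (u i)) \<and> X 0 = mat 1 \<and> continuous_on {0..T} X \<and>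
     (\<exists>S. finite S \<and> (\<forall>t\<in>{0<..<T} - S.
        (X has_vector_derivative ((B0 + (\<Sum>i<length Bs. u i t *\<^sub>R Bs ! i)) ** X t)) (at t)))"

lemma trajectory_reachable:
  assumes "trajectory B0 Bs u T X" shows "reachable_at B0 Bs T (X T)"
proof -
  obtain S where S: "finite S" "\<And>t. t \<in> {0<..<T} - S \<Longrightarrow>
      (X has_vector_derivative ((B0 + (\<Sum>i<length Bs. u i t *\<^sub>R Bs ! i)) ** X t)) (at t)"
    using assms unfolding trajectory_def by blast
  have "is_solution B0 Bs u T X"
    unfolding is_solution_def
    using assms S(1)
    by (intro conjI exI[of _ "S \<union> {0, T}"])
      (auto simp: trajectory_def intro!: has_vector_derivative_at_within S(2))
  moreover have "\<forall>i<length Bs. piecewise_continuous_on 0 T (u i)"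
    using assms by (auto simp: trajectory_def intro: regulated_piecewise_continuous_on)
  ultimately show ?thesis
    unfolding reachable_at_def by blast
qed

lemma trajectory_append:
  assumes tr: "trajectory B0 Bs u T X" and \<tau>: "0 \<le> \<tau>"
    and Z: "Z = B0 + (\<Sum>i<length Bs. c i *\<^sub>R Bs ! i)"
  shows "\<exists>v W. trajectory B0 Bs v (T + \<tau>) W \<and> W (T + \<tau>) = mexp (\<tau> *\<^sub>R Z) ** X T"
proof -
  define v where "v i t = (if t \<le> T then u i t else c i)" for i t
  define W where "W t = (if t \<le> T then X t else mexp ((t - T) *\<^sub>R Z) ** X T)" for t
  obtain S where S: "finite S" "\<And>t. t \<in> {0<..<T} - S \<Longrightarrow>
      (X has_vector_derivative ((B0 + (\<Sum>i<length Bs. u i t *\<^sub>R Bs ! i)) ** X t)) (at t)"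
    using tr unfolding trajectory_def by blast
  have T: "0 \<le> T" and X: "X 0 = mat 1" "continuous_on {0..T} X" and u: "\<And>i. regulated (u i)"
    using tr by (auto simp: trajectory_def)
  have E: "((\<lambda>t. mexp ((t - T) *\<^sub>R Z) ** X T) has_vector_derivative
      Z ** (mexp ((t - T) *\<^sub>R Z) ** X T)) (at t)" for t
  proof -
    have "((\<lambda>t. t - T) has_vector_derivative 1) (at t)"
      unfolding has_real_derivative_iff_has_vector_derivative[symmetric]
      by (auto intro!: derivative_eq_intros)
    from vector_diff_chain_at[OF this mexp_has_vector_derivative[of Z]]
    have "((\<lambda>t. mexp ((t - T) *\<^sub>R Z)) has_vector_derivative Z ** mexp ((t - T) *\<^sub>R Z)) (at t)"
      by (simp add: o_def)
    from bounded_linear.has_vector_derivative[OF mm.bounded_linear_left this]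
    show ?thesis by (simp add: matrix_mul_assoc)
  qed
  have "continuous_on ({0..T} \<union> {T..T + \<tau>}) W"
    unfolding W_def
  proof (rule continuous_on_If)
    show "continuous_on {T..T + \<tau>} (\<lambda>t. mexp ((t - T) *\<^sub>R Z) ** X T)"
      by (rule continuous_on_vector_derivative) (rule has_vector_derivative_at_within[OF E])
  qed (use X in \<open>auto simp: T\<close>)
  moreover have "{0..T} \<union> {T..T + \<tau>} = {0..T + \<tau>}"
    using T \<tau> by auto
  \<comment> \<open>The switching time \<open>T\<close>, where \<open>W\<close> may have a corner,
    is put into the exceptional set.\<close>
  moreover have "(W has_vector_derivative ((B0 + (\<Sum>i<length Bs. v i t *\<^sub>R Bs ! i)) ** W t)) (at t)"
    if t: "t \<in> {0<..<T + \<tau>} - insert T S" for t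
  proof (cases "t < T")
    case True
    then have "(X has_vector_derivative ((B0 + (\<Sum>i<length Bs. v i t *\<^sub>R Bs ! i)) ** W t)) (at t)"
      using S(2)[of t] t by (simp add: v_def W_def)
    then show ?thesis
      by (rule has_vector_derivative_transform_within_open[of _ _ _ "{..<T}"])
        (use True in \<open>auto simp: W_def\<close>)
  next
    case False
    then have "T < t" using t by auto
    then have "((\<lambda>t. mexp ((t - T) *\<^sub>R Z) ** X T) has_vector_derivative
        ((B0 + (\<Sum>i<length Bs. v i t *\<^sub>R Bs ! i)) ** W t)) (at t)"
      using E[of t] by (simp add: v_def W_def Z)
    then show ?thesis
      by (rule has_vector_derivative_transform_within_open[of _ _ _ "{T<..}"])
        (use \<open>T < t\<close> in \<open>auto simp: W_def\<close>)
  qed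
  moreover have "regulated (v i)" for i
    unfolding v_def by (intro regulated_append u)
  ultimately have "trajectory B0 Bs v (T + \<tau>) W"
    unfolding trajectory_def using T \<tau> S(1) X(1)
    by (intro conjI exI[of _ "insert T S"]) (auto simp: W_def)
  moreover have "W (T + \<tau>) = mexp (\<tau> *\<^sub>R Z) ** X T"
    using \<tau> by (auto simp: W_def)
  ultimately show ?thesis by blast
qed

lemma exp_semigroup_reachable:
  assumes "Y \<in> exp_semigroup (velocities B0 Bs)"
  shows "\<exists>T\<ge>0. reachable_at B0 Bs T Y"
proof -
  have "\<exists>u T X. trajectory B0 Bs u T X \<and> X T = Y"
    using assms
  proof induction
    case one
    have "trajectory B0 Bs (\<lambda>i t. 0) 0 (\<lambda>t. mat 1)"
      by (auto simp: trajectory_def regulated_const)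
    then show ?case by blast
  next
    case (step Y Z t)
    then obtain c u T X where "Z = B0 + (\<Sum>i<length Bs. c i *\<^sub>R Bs ! i)"
      and "trajectory B0 Bs u T X" "X T = Y"
      unfolding velocities_def by auto
    then show ?case
      using trajectory_append[of B0 Bs u T X t Z c] step.hyps by auto
  qed
  then obtain u T X where *: "trajectory B0 Bs u T X" "X T = Y" by blast
  moreover have "0 \<le> T" using *(1) by (simp add: trajectory_def)
  ultimately show ?thesis using trajectory_reachable by blast
qed

section \<open>Brackets with skew-Hermitian matrix units\<close>

abbreviation commutator :: "'n::finite cmat \<Rightarrow> 'n cmat \<Rightarrow> 'n cmat" where
  "commutator A B \<equiv> A ** B - B ** A"

text \<open>B and C are the values at \<open>1\<close> and \<open>\<i>\<close>. One complex
  parameter for both turns their bracket table into multiplication of complex numbers.\<close>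

definition skew_unit :: "complex \<Rightarrow> 'n::finite \<Rightarrow> 'n \<Rightarrow> 'n cmat" where
  "skew_unit z a b = (\<chi> k l. if k = a \<and> l = b then z else if k = b \<and> l = a then - cnj z else 0)"

lemma skew_unit_entry:
  "skew_unit z a b $ k $ l = (if k = a \<and> l = b then z else if k = b \<and> l = a then - cnj z else 0)"
  by (simp add: skew_unit_def)

lemma Bmat_eq_skew_unit: "a \<noteq> b \<Longrightarrow> Bmat a b = skew_unit 1 a b"
  by (auto simp: Bmat_def Emat_def skew_unit_def vec_eq_iff)

lemma Cmat_eq_skew_unit: "a \<noteq> b \<Longrightarrow> Cmat a b = skew_unit \<i> a b"
  by (auto simp: Cmat_def Emat_def skew_unit_def vec_eq_iff)

lemma Dmat_entry:
  "Dmat a b $ k $ l = (if k = l then \<i> * ((if k = a then 1 else 0) - (if k = b then 1 else 0)) else 0)"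
  by (auto simp: Dmat_def Emat_def)

lemma skew_unit_scaleR: "skew_unit (of_real r * z) a b = r *\<^sub>R skew_unit z a b"
  unfolding vec_eq_iff vector_scaleR_component skew_unit_entry scaleR_conv_of_real[where 'a=complex]
  by simp

lemma skew_unit_add: "a \<noteq> b \<Longrightarrow> skew_unit (z + w) a b = skew_unit z a b + skew_unit w a b"
  by (auto simp: vec_eq_iff skew_unit_entry)

lemma skew_unit_swap: "a \<noteq> b \<Longrightarrow> skew_unit (cnj z) b a = - skew_unit z a b"
  by (auto simp: vec_eq_iff skew_unit_entry)

lemma skew_unit_mult_entry:
  fixes X :: "'n::finite cmat"
  assumes "a \<noteq> b"
  shows "(skew_unit z a b ** X) $ k $ l =
      (if k = a then z * X $ b $ l else if k = b then - cnj z * X $ a $ l else 0)"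
proof -
  have "(skew_unit z a b ** X) $ k $ l = (\<Sum>m\<in>UNIV. skew_unit z a b $ k $ m * X $ m $ l)"
    by (simp add: matrix_matrix_mult_def)
  also have "\<dots> = (\<Sum>m\<in>UNIV. if m = b then (if k = a then z * X $ b $ l else 0) else
      if m = a then (if k = b then - cnj z * X $ a $ l else 0) else 0)"
    by (rule sum.cong) (auto simp: skew_unit_entry)
  also have "\<dots> = (\<Sum>m\<in>{a, b}. if m = b then (if k = a then z * X $ b $ l else 0) else
      if m = a then (if k = b then - cnj z * X $ a $ l else 0) else 0)"
    by (rule sum.mono_neutral_right) auto
  finally show ?thesis using assms by auto
qed

lemma mult_skew_unit_entry:
  fixes X :: "'n::finite cmat"
  assumes "a \<noteq> b"
  shows "(X ** skew_unit z a b) $ k $ l =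
      (if l = b then X $ k $ a * z else if l = a then - X $ k $ b * cnj z else 0)"
proof -
  have "(X ** skew_unit z a b) $ k $ l = (\<Sum>m\<in>UNIV. X $ k $ m * skew_unit z a b $ m $ l)"
    by (simp add: matrix_matrix_mult_def)
  also have "\<dots> = (\<Sum>m\<in>UNIV. if m = a then (if l = b then X $ k $ a * z else 0) else
      if m = b then (if l = a then - X $ k $ b * cnj z else 0) else 0)"
    by (rule sum.cong) (auto simp: skew_unit_entry)
  also have "\<dots> = (\<Sum>m\<in>{a, b}. if m = a then (if l = b then X $ k $ a * z else 0) else
      if m = b then (if l = a then - X $ k $ b * cnj z else 0) else 0)"
    by (rule sum.mono_neutral_right) auto
  finally show ?thesis using assms by auto
qed

text \<open>Of all products of matrix units only those through the shared index \<open>b\<close>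
  survive. The multiplicative coefficient is what later makes the colours a cocycle modulo
  2.\<close>

lemma commutator_skew_unit:
  assumes "a \<noteq> b" "b \<noteq> c" "a \<noteq> c"
  shows "commutator (skew_unit z a b) (skew_unit w b c) = skew_unit (z * w) a c"
proof -
  have "commutator (skew_unit z a b) (skew_unit w b c) $ k $ l = skew_unit (z * w) a c $ k $ l" for k l
    by (cases "k = a"; cases "k = b"; cases "k = c"; cases "l = a"; cases "l = b"; cases "l = c")
      (use assms in \<open>simp_all add: skew_unit_mult_entry skew_unit_entry\<close>)
  then show ?thesis by (simp add: vec_eq_iff)
qed

section \<open>Isolating entries by double brackets\<close>

abbreviation ad2 :: "complex \<Rightarrow> 'n::finite \<Rightarrow> 'n \<Rightarrow> 'n cmat \<Rightarrow> 'n cmat" where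
  "ad2 e a b X \<equiv> commutator (skew_unit e a b) (commutator (skew_unit e a b) X)"

lemma ad2_entry_one:
  assumes "a \<noteq> b" "e * cnj e = 1" "(k = a \<or> k = b) \<noteq> (l = a \<or> l = b)"
  shows "ad2 e a b X $ k $ l = - X $ k $ l"
proof -
  have e: "cnj e * e = 1" "\<And>x. e * (cnj e * x) = x" "\<And>x. cnj e * (e * x) = x"
    using assms(2) by (metis mult.commute, metis mult.assoc mult_1, metis mult.assoc mult.commute mult_1)
  show ?thesis
    using assms(1,3)
    by (auto simp: skew_unit_mult_entry mult_skew_unit_entry e mult.assoc assms(2))
qed

lemma ad2_entry_none:
  assumes "a \<noteq> b" "k \<noteq> a" "k \<noteq> b" "l \<noteq> a" "l \<noteq> b"
  shows "ad2 e a b X $ k $ l = 0"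
  using assms by (simp add: skew_unit_mult_entry mult_skew_unit_entry)

lemma ad2_entry_vanish:
  assumes "a \<noteq> b" "e * cnj e = 1"
    and "X $ a $ a = 0" "X $ a $ b = 0" "X $ b $ a = 0" "X $ b $ b = 0"
  shows "ad2 e a b X $ k $ l = (if (k = a \<or> k = b) \<noteq> (l = a \<or> l = b) then - X $ k $ l else 0)"
proof (cases "(k = a \<or> k = b) \<noteq> (l = a \<or> l = b)")
  case True
  then show ?thesis using ad2_entry_one[OF assms(1,2) True] by simp
next
  case False
  then show ?thesis using assms
    by (auto simp: skew_unit_mult_entry mult_skew_unit_entry)
qed

text \<open>For \<open>x = skew_unit e a b\<close> with \<open>\<bar>e\<bar> = 1\<close>, the operator \<open>- ad x \<circ> ad x\<close> keeps the entries with
  exactly one index in \<open>{a, b}\<close> and kills those with none, so four such operators cut out a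
  single entry.\<close>

lemma ad2_isolates_entry:
  assumes dist: "distinct [a, b, c, a', b', c']"
    and e: "e1 * cnj e1 = 1" "e2 * cnj e2 = 1" "d1 * cnj d1 = 1" "d2 * cnj d2 = 1"
    and B: "adjoint_mat B = - B"
  shows "ad2 e1 a b (ad2 e2 a c (ad2 d1 a' b' (ad2 d2 a' c' B))) = skew_unit (B $ a $ a') a a'"
proof -
  define X1 where "X1 = ad2 d2 a' c' B"
  define X2 where "X2 = ad2 d1 a' b' X1"
  define X3 where "X3 = ad2 e2 a c X2"
  define X4 where "X4 = ad2 e1 a b X3"
  have X1: "X1 $ k $ l = - B $ k $ l" if "(k = a' \<or> k = c') \<noteq> (l = a' \<or> l = c')" for k l
    unfolding X1_def using dist that by (intro ad2_entry_one e) auto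
  have X1': "X1 $ k $ l = 0" if "k \<noteq> a'" "k \<noteq> c'" "l \<noteq> a'" "l \<noteq> c'" for k l
    unfolding X1_def using dist that by (intro ad2_entry_none) auto
  have X2: "X2 $ k $ l = - X1 $ k $ l" if "(k = a' \<or> k = b') \<noteq> (l = a' \<or> l = b')" for k l
    unfolding X2_def using dist that by (intro ad2_entry_one e) auto
  have X2': "X2 $ k $ l = 0" if "k \<noteq> a'" "k \<noteq> b'" "l \<noteq> a'" "l \<noteq> b'" for k l
    unfolding X2_def using dist that by (intro ad2_entry_none) auto
  \<comment> \<open>A double bracket also acts inside its own block. The primed operators have
    already cleared the block on \<open>{a, b, c}\<close>, so the last two are pure projections up
    to sign, and these discard whatever is left in the primed block.\<close>
  have X3: "X3 $ k $ l = (if (k = a \<or> k = c) \<noteq> (l = a \<or> l = c) then - X2 $ k $ l else 0)" for k l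
    unfolding X3_def using dist by (intro ad2_entry_vanish e X2') auto
  have X4: "X4 $ k $ l = (if (k = a \<or> k = b) \<noteq> (l = a \<or> l = b) then - X3 $ k $ l else 0)" for k l
    unfolding X4_def using dist by (intro ad2_entry_vanish e) (auto simp: X3 X2')
  have row: "X2 $ a $ l = (if l = a' then B $ a $ a' else 0)"
    and col: "X2 $ l $ a = (if l = a' then B $ a' $ a else 0)" for l
    using dist by (cases "l = a'"; cases "l = b'"; auto simp: X2 X2' X1 X1')+
  have "B $ a' $ a = - cnj (B $ a $ a')"
    using B unfolding adjoint_mat_def vec_eq_iff
    by simp
  then have "X4 $ k $ l = skew_unit (B $ a $ a') a a' $ k $ l" for k l
    using dist by (auto simp: X4 X3 row col X2' skew_unit_entry)
  then show ?thesis
    by (simp add: vec_eq_iff X1_def X2_def X3_def X4_def)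
qed

lemma commutator_skew_unit_Dmat:
  assumes "a \<noteq> b"
  shows "commutator (skew_unit e a b) (Dmat a b) = (- 2) *\<^sub>R skew_unit (\<i> * e) a b"
  using assms
  by (auto simp: vec_eq_iff skew_unit_mult_entry mult_skew_unit_entry skew_unit_entry Dmat_entry
      scaleR_conv_of_real[where 'a=complex])

lemma commutator_skew_unit_rotated:
  assumes "a \<noteq> b" "e * cnj e = 1"
  shows "commutator (skew_unit e a b) (skew_unit (\<i> * e) a b) = 2 *\<^sub>R Dmat a b"
  using assms
  by (auto simp: vec_eq_iff skew_unit_mult_entry mult_skew_unit_entry skew_unit_entry Dmat_entry
      scaleR_conv_of_real[where 'a=complex] algebra_simps)

text \<open>On the span of \<open>skew_unit (\<i> * e) a b\<close> and \<open>Dmat a b\<close> the operator \<open>- ad x \<circ> ad x\<close> is \<open>4\<close>,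
  and on the entries with one index in \<open>{a, b}\<close> it is \<open>1\<close>.\<close>

lemma ad2_isolates_block:
  assumes ab: "a \<noteq> b" and e: "e * cnj e = 1" and B: "adjoint_mat B = - B"
  shows "ad2 e a b (ad2 e a b B) + ad2 e a b B =
    (12 * Im (cnj e * B $ a $ b)) *\<^sub>R skew_unit (\<i> * e) a b
    + (6 * (Im (B $ a $ a) - Im (B $ b $ b))) *\<^sub>R Dmat a b"
proof -
  have e': "cnj e * e = 1" "\<And>x. e * (cnj e * x) = x" "\<And>x. cnj e * (e * x) = x"
    using e by (metis mult.commute, metis mult.assoc mult_1, metis mult.assoc mult.commute mult_1)
  define x where "x = skew_unit e a b"
  have blk: "commutator x X $ a $ a = e * X $ b $ a + cnj e * X $ a $ b"
    "commutator x X $ b $ b = - (e * X $ b $ a + cnj e * X $ a $ b)"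
    "commutator x X $ a $ b = e * (X $ b $ b - X $ a $ a)"
    "commutator x X $ b $ a = cnj e * (X $ b $ b - X $ a $ a)" for X
    using ab by (auto simp: x_def skew_unit_mult_entry mult_skew_unit_entry algebra_simps)
  define Y where "Y = commutator x (commutator x B)"
  define W where "W = commutator x (commutator x Y)"
  have sk: "B $ b $ a = - cnj (B $ a $ b)" "Re (B $ a $ a) = 0" "Re (B $ b $ b) = 0"
  proof -
    have *: "cnj (B $ l $ k) = - B $ k $ l" for k l
      using B unfolding adjoint_mat_def vec_eq_iff by simp
    show "B $ b $ a = - cnj (B $ a $ b)" using *[of a b] by simp
    show "Re (B $ a $ a) = 0" "Re (B $ b $ b) = 0"
      using arg_cong[OF *[of a a], of Re] arg_cong[OF *[of b b], of Re] by simp_all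
  qed
  have Y: "Y $ a $ a = 2 * (B $ b $ b - B $ a $ a)" "Y $ b $ b = - 2 * (B $ b $ b - B $ a $ a)"
    "Y $ a $ b = - 2 * e * (e * B $ b $ a + cnj e * B $ a $ b)"
    "Y $ b $ a = - 2 * cnj e * (e * B $ b $ a + cnj e * B $ a $ b)"
    unfolding Y_def blk by (simp_all add: e e' algebra_simps)
  have W: "W $ a $ a = - 4 * Y $ a $ a" "W $ b $ b = - 4 * Y $ b $ b"
    "W $ a $ b = - 4 * Y $ a $ b" "W $ b $ a = - 4 * Y $ b $ a"
    unfolding W_def blk Y by (simp_all add: e e' algebra_simps)
  have q: "e * B $ b $ a + cnj e * B $ a $ b = 2 * \<i> * of_real (Im (cnj e * B $ a $ b))"
    unfolding sk by (simp add: complex_eq_iff)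
  have d: "B $ b $ b - B $ a $ a = - \<i> * of_real (Im (B $ a $ a) - Im (B $ b $ b))"
    using sk by (simp add: complex_eq_iff)
  \<comment> \<open>In the block \<open>W = - 4 Y\<close>, so the sum is \<open>- 3 Y\<close>, and
    \<open>Y\<close> is \<open>- 4\<close> times the component of \<open>B\<close> in the plane:
    hence 12. The \<open>Dmat\<close> coefficient of \<open>B\<close> is half the difference of the
    diagonal imaginary parts: hence 6. On entries with one index in the block
    \<open>W = - Y\<close>, and the sum cancels.\<close>
  have "(W + Y) $ k $ l = ((12 * Im (cnj e * B $ a $ b)) *\<^sub>R skew_unit (\<i> * e) a b
    + (6 * (Im (B $ a $ a) - Im (B $ b $ b))) *\<^sub>R Dmat a b) $ k $ l" (is "_ = ?R $ k $ l") for k l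
  proof -
    consider "(k = a \<or> k = b) \<noteq> (l = a \<or> l = b)" | "k \<noteq> a" "k \<noteq> b" "l \<noteq> a" "l \<noteq> b"
      | "k = a" "l = a" | "k = a" "l = b" | "k = b" "l = a" | "k = b" "l = b"
      by blast
    then show ?thesis
    proof cases
      case 1
      then have "W $ k $ l = - Y $ k $ l"
        unfolding W_def x_def by (intro ad2_entry_one ab e) auto
      moreover have "?R $ k $ l = 0" using 1 ab by (auto simp: skew_unit_entry Dmat_entry)
      ultimately show ?thesis by simp
    next
      case 2
      then have "W $ k $ l = 0" "Y $ k $ l = 0"
        unfolding W_def Y_def x_def by (intro ad2_entry_none ab; simp)+
      moreover have "?R $ k $ l = 0" using 2 by (auto simp: skew_unit_entry Dmat_entry)
      ultimately show ?thesis by simp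
    qed (use ab in \<open>simp_all add: W Y q d skew_unit_entry Dmat_entry scaleR_conv_of_real[where 'a=complex] algebra_simps\<close>)
  qed
  then show ?thesis
    by (simp add: vec_eq_iff W_def Y_def x_def)
qed

section \<open>Real Lie algebras of matrices and the units they contain\<close>

locale lie_algebra =
  fixes L :: "'n::finite cmat set"
  assumes subspace: "subspace L"
    and commutator_closed: "A \<in> L \<Longrightarrow> B \<in> L \<Longrightarrow> commutator A B \<in> L"
begin

definition linked :: "'n \<Rightarrow> 'n \<Rightarrow> bool" where
  "linked a b \<longleftrightarrow> a \<noteq> b \<and> (skew_unit 1 a b \<in> L \<or> skew_unit \<i> a b \<in> L)"

text \<open>Quantifying over all \<open>z\<close> instead of the two units lets the phase of a
  linking unit be absorbed when fullness is passed along a link.\<close>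

definition full :: "'n \<Rightarrow> 'n \<Rightarrow> bool" where
  "full a b \<longleftrightarrow> a \<noteq> b \<and> (\<forall>z. skew_unit z a b \<in> L)"

lemma skew_unit_trans:
  assumes "skew_unit z a b \<in> L" "skew_unit w b c \<in> L" "a \<noteq> b" "b \<noteq> c" "a \<noteq> c"
  shows "skew_unit (z * w) a c \<in> L"
  using commutator_closed[OF assms(1,2)] commutator_skew_unit[OF assms(3-5)] by simp

lemma skew_unit_cnj_swap: "skew_unit z a b \<in> L \<Longrightarrow> a \<noteq> b \<Longrightarrow> skew_unit (cnj z) b a \<in> L"
  by (simp only: skew_unit_swap subspace_neg[OF subspace] not_False_eq_True)

lemma skew_unit_uminus: "skew_unit (- z) a b \<in> L \<longleftrightarrow> skew_unit z a b \<in> L"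
proof -
  have "skew_unit (- z) a b = - skew_unit z a b" for z :: complex
    by (auto simp: vec_eq_iff skew_unit_entry)
  then show ?thesis using subspace_neg[OF subspace] by (metis minus_minus)
qed

lemma skew_unit_scale_iff:
  assumes "r \<noteq> 0"
  shows "skew_unit (of_real r * z) a b \<in> L \<longleftrightarrow> skew_unit z a b \<in> L"
proof
  assume "skew_unit (of_real r * z) a b \<in> L"
  then have "inverse r *\<^sub>R skew_unit (of_real r * z) a b \<in> L"
    by (rule subspace_scale[OF subspace])
  then show "skew_unit z a b \<in> L"
    using assms by (simp add: skew_unit_scaleR)
qed (simp only: skew_unit_scaleR subspace_scale[OF subspace])

lemma linked_sym: "linked a b \<Longrightarrow> linked b a"
  unfolding linked_def
  using skew_unit_cnj_swap[of 1 a b] skew_unit_cnj_swap[of \<i> a b] by (auto simp: skew_unit_uminus)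

lemma linked_unit:
  assumes "linked a b"
  obtains e where "e = 1 \<or> e = \<i>" "e * cnj e = 1" "skew_unit e a b \<in> L"
proof (cases "skew_unit 1 a b \<in> L")
  case True
  then show ?thesis using that[of 1] by simp
next
  case False
  then show ?thesis using that[of \<i>] assms by (simp add: linked_def)
qed

lemma linked_trans:
  assumes "linked a b" "linked b c" "a \<noteq> c"
  shows "linked a c"
proof -
  obtain e where e: "e = 1 \<or> e = \<i>" "skew_unit e a b \<in> L" using linked_unit assms(1) by metis
  obtain d where d: "d = 1 \<or> d = \<i>" "skew_unit d b c \<in> L" using linked_unit assms(2) by metis
  have "skew_unit (e * d) a c \<in> L"
    using assms by (intro skew_unit_trans[OF e(2) d(2)]) (auto simp: linked_def)
  then show ?thesis
    using e(1) d(1) assms(3) skew_unit_uminus[of 1 a c] by (auto simp: linked_def)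
qed

lemma fullI:
  assumes "a \<noteq> b" "skew_unit 1 a b \<in> L" "skew_unit \<i> a b \<in> L"
  shows "full a b"
  unfolding full_def
proof (intro conjI allI)
  fix z
  have "skew_unit z a b = skew_unit (of_real (Re z) * 1 + of_real (Im z) * \<i>) a b"
    by (metis complex_eq mult.commute mult.right_neutral)
  also have "\<dots> = Re z *\<^sub>R skew_unit 1 a b + Im z *\<^sub>R skew_unit \<i> a b"
    by (simp only: skew_unit_add[OF assms(1)] skew_unit_scaleR)
  finally show "skew_unit z a b \<in> L"
    using assms subspace by (simp add: subspace_add subspace_scale)
qed fact

lemma full_if_rotated:
  assumes "a \<noteq> b" "e = 1 \<or> e = \<i>" "skew_unit e a b \<in> L" "skew_unit (\<i> * e) a b \<in> L"
  shows "full a b"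
proof (rule fullI[OF assms(1)])
  show "skew_unit 1 a b \<in> L" "skew_unit \<i> a b \<in> L"
    using assms(2-4) skew_unit_uminus[of 1 a b] by auto
qed

lemma full_if_Dmat:
  assumes "linked a b" "Dmat a b \<in> L"
  shows "full a b"
proof -
  have ab: "a \<noteq> b" using assms(1) by (simp add: linked_def)
  obtain e where e: "e = 1 \<or> e = \<i>" "skew_unit e a b \<in> L"
    using linked_unit[OF assms(1)] by metis
  have "(- 2) *\<^sub>R skew_unit (\<i> * e) a b \<in> L"
    using commutator_closed[OF e(2) assms(2)] commutator_skew_unit_Dmat[OF ab] by simp
  then have "(- 1 / 2) *\<^sub>R ((- 2) *\<^sub>R skew_unit (\<i> * e) a b) \<in> L"
    by (rule subspace_scale[OF subspace])
  then show ?thesis using full_if_rotated[OF ab e] by simp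
qed

text \<open>The component of \<open>B\<close> in the plane of
  \<open>skew_unit (\<i> * e) a b\<close> and \<open>Dmat a b\<close> lies in \<open>L\<close>.
  Bracketing with the given unit rotates this plane, so a nonzero component generates the whole
  plane and makes the pair full.\<close>

lemma full_or_aligned:
  assumes lnk: "linked a b" and e: "e = 1 \<or> e = \<i>" "skew_unit e a b \<in> L"
    and B: "B \<in> L" "adjoint_mat B = - B" and nf: "\<not> full a b"
  shows "Im (cnj e * B $ a $ b) = 0" "Im (B $ a $ a) = Im (B $ b $ b)"
proof -
  have ab: "a \<noteq> b" using lnk by (simp add: linked_def)
  have ee: "e * cnj e = 1" using e(1) by auto
  define p where "p = 12 * Im (cnj e * B $ a $ b)"
  define q where "q = 6 * (Im (B $ a $ a) - Im (B $ b $ b))"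
  define M where "M = skew_unit (\<i> * e) a b"
  define G where "G = p *\<^sub>R M + q *\<^sub>R Dmat a b"
  have ad2: "ad2 e a b X \<in> L" if "X \<in> L" for X
    by (intro commutator_closed e that)
  have G: "G \<in> L"
    unfolding G_def p_def q_def M_def ad2_isolates_block[OF ab ee B(2), symmetric]
    by (intro subspace_add[OF subspace] ad2 B(1))
  have "commutator (skew_unit e a b) G = p *\<^sub>R (2 *\<^sub>R Dmat a b) + q *\<^sub>R ((- 2) *\<^sub>R M)"
    unfolding G_def M_def commutator_skew_unit_Dmat[OF ab, symmetric]
      commutator_skew_unit_rotated[OF ab ee, symmetric]
    by (simp add: mm.add_right mm.add_left mm.scaleR_right mm.scaleR_left algebra_simps)
  then have "p *\<^sub>R (2 *\<^sub>R Dmat a b) + q *\<^sub>R ((- 2) *\<^sub>R M) \<in> L"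
    using commutator_closed[OF e(2) G] by simp
  \<comment> \<open>The coefficients solve a 2 by 2 system that eliminates \<open>Dmat a b\<close>;
    its determinant is proportional to the sum of squares that remains in front of
    \<open>M\<close>.\<close>
  then have "p *\<^sub>R G - (q / 2) *\<^sub>R (p *\<^sub>R (2 *\<^sub>R Dmat a b) + q *\<^sub>R ((- 2) *\<^sub>R M)) \<in> L"
    by (intro subspace_diff[OF subspace] subspace_scale[OF subspace] G)
  also have "p *\<^sub>R G - (q / 2) *\<^sub>R (p *\<^sub>R (2 *\<^sub>R Dmat a b) + q *\<^sub>R ((- 2) *\<^sub>R M)) = (p\<^sup>2 + q\<^sup>2) *\<^sub>R M"
    by (simp add: G_def algebra_simps power2_eq_square)
  finally have *: "(p\<^sup>2 + q\<^sup>2) *\<^sub>R M \<in> L" .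
  have "p\<^sup>2 + q\<^sup>2 = 0"
  proof (rule ccontr)
    assume "p\<^sup>2 + q\<^sup>2 \<noteq> 0"
    then have "M \<in> L"
      using subspace_scale[OF subspace *, of "inverse (p\<^sup>2 + q\<^sup>2)"] by simp
    then show False using full_if_rotated[OF ab e] nf by (simp add: M_def)
  qed
  then have "p = 0" "q = 0" by (simp_all add: sum_power2_eq_zero_iff)
  then show "Im (cnj e * B $ a $ b) = 0" "Im (B $ a $ a) = Im (B $ b $ b)"
    by (simp_all add: p_def q_def)
qed

lemma isolate_entry:
  assumes "distinct [a, b, c, a', b', c']"
    and "linked a b" "linked a c" "linked a' b'" "linked a' c'"
    and B: "B \<in> L" "adjoint_mat B = - B"
  shows "skew_unit (B $ a $ a') a a' \<in> L"
proof -
  obtain e1 where e1: "e1 * cnj e1 = 1" "skew_unit e1 a b \<in> L" using linked_unit assms(2) by metis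
  obtain e2 where e2: "e2 * cnj e2 = 1" "skew_unit e2 a c \<in> L" using linked_unit assms(3) by metis
  obtain d1 where d1: "d1 * cnj d1 = 1" "skew_unit d1 a' b' \<in> L" using linked_unit assms(4) by metis
  obtain d2 where d2: "d2 * cnj d2 = 1" "skew_unit d2 a' c' \<in> L" using linked_unit assms(5) by metis
  show ?thesis
    unfolding ad2_isolates_entry[OF assms(1) e1(1) e2(1) d1(1) d2(1) B(2), symmetric]
    by (intro commutator_closed e1 e2 d1 d2 B)
qed

lemma full_sym: "full a b \<Longrightarrow> full b a"
  unfolding full_def
proof (intro conjI allI)
  fix z
  assume "a \<noteq> b \<and> (\<forall>z. skew_unit z a b \<in> L)"
  then show "skew_unit z b a \<in> L"
    using skew_unit_cnj_swap[of "cnj z" a b] by simp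
qed auto

lemma full_trans:
  assumes "full a b" "linked b c" "a \<noteq> c"
  shows "full a c"
proof -
  obtain e where e: "e * cnj e = 1" "skew_unit e b c \<in> L" using linked_unit assms(2) by metis
  have "skew_unit z a c \<in> L" for z
  proof -
    have "skew_unit (z * cnj e * e) a c \<in> L"
      using assms e by (intro skew_unit_trans[of "z * cnj e" a b e c]) (auto simp: full_def linked_def)
    moreover have "z * cnj e * e = z" using e(1) by (simp add: mult.commute mult.left_commute)
    ultimately show ?thesis by simp
  qed
  then show ?thesis using assms(3) by (simp add: full_def)
qed

lemma su_subset_if_full:
  assumes lnk: "\<And>a b. a \<noteq> b \<Longrightarrow> linked a b" and "full a b"
  shows "su \<subseteq> L"
proof -
  have full: "full c d" if "c \<noteq> d" for c d
  proof -
    have "full c a \<or> c = a"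
      using full_trans[OF \<open>full a b\<close>, of c] full_sym lnk \<open>full a b\<close> by metis
    then show ?thesis
      using full_trans[of c a d] lnk[of a d] full_trans[OF \<open>full a b\<close>, of d] lnk[of b d] that \<open>full a b\<close>
      by metis
  qed
  have D: "Dmat c d \<in> L" for c d
  proof (cases "c = d")
    case True
    then have "Dmat c d = 0" by (simp add: vec_eq_iff Dmat_entry)
    then show ?thesis using subspace_0[OF subspace] by simp
  next
    case False
    have "2 *\<^sub>R Dmat c d \<in> L"
      unfolding commutator_skew_unit_rotated[OF False, of 1, simplified, symmetric]
      using full[OF False] by (intro commutator_closed) (auto simp: full_def)
    from subspace_scale[OF subspace this, of "1/2"] show ?thesis by simp
  qed
  show ?thesis
  proof
    fix A :: "'n cmat"
    assume A: "A \<in> su"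
    have adjA: "cnj (A $ l $ k) = - A $ k $ l" for k l
      using A by (auto simp: su_def adjoint_mat_def vec_eq_iff)
    have ReA: "Re (A $ k $ k) = 0" for k
      using arg_cong[OF adjA[of k k], of Re] by simp
    have ImA: "(\<Sum>k\<in>UNIV. Im (A $ k $ k)) = 0"
      using A by (simp add: su_def mtrace_def flip: Im_sum)
    \<comment> \<open>The sum runs over ordered pairs and meets every off-diagonal entry twice,
      hence the factor 1/2.\<close>
    define P where "P = (\<Sum>c\<in>UNIV. \<Sum>d\<in>UNIV. if c = d then 0 else (1/2) *\<^sub>R skew_unit (A $ c $ d) c d)"
    \<comment> \<open>All diagonal differences are taken against the base index \<open>a\<close>;
      the entry at \<open>a\<close> itself comes out right because the trace is zero.\<close>
    define Q where "Q = (\<Sum>c\<in>UNIV. Im (A $ c $ c) *\<^sub>R Dmat c a)"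
    have "A $ k $ l = (P + Q) $ k $ l" for k l
    proof (cases "k = l")
      case True
      have "P $ k $ l = 0"
        unfolding P_def sum_component by (rule sum.neutral, rule ballI, rule sum.neutral) (auto simp: True skew_unit_entry)
      moreover have "Q $ k $ l = \<i> * of_real (Im (A $ k $ k))"
      proof -
        have "Q $ k $ l = (\<Sum>c\<in>UNIV. \<i> * (if c = k then of_real (Im (A $ k $ k)) else 0)
            - (\<i> * (if k = a then 1 else 0)) * of_real (Im (A $ c $ c)))"
          unfolding Q_def sum_component
          by (rule sum.cong) (auto simp: True Dmat_entry scaleR_conv_of_real[where 'a=complex] algebra_simps)
        also have "\<dots> = \<i> * of_real (Im (A $ k $ k)) -
            (\<i> * (if k = a then 1 else 0)) * of_real (\<Sum>c\<in>UNIV. Im (A $ c $ c))"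
          by (simp add: sum_subtractf flip: sum_distrib_left)
        finally show ?thesis using ImA by simp
      qed
      ultimately show ?thesis using ReA[of k] True by (simp add: complex_eq_iff)
    next
      case False
      have "P $ k $ l = (\<Sum>c\<in>UNIV. \<Sum>d\<in>UNIV.
          (if d = l then if c = k then A $ k $ l / 2 else 0 else 0) +
          (if d = k then if c = l then - cnj (A $ l $ k) / 2 else 0 else 0))"
        unfolding P_def sum_component
        by (intro sum.cong refl) (use False in \<open>auto simp: skew_unit_entry scaleR_conv_of_real[where 'a=complex]\<close>)
      also have "\<dots> = A $ k $ l / 2 + - cnj (A $ l $ k) / 2"
        by (simp add: sum.distrib)
      finally have "P $ k $ l = A $ k $ l" by (simp add: adjA)
      moreover have "Q $ k $ l = 0"
        unfolding Q_def sum_component by (rule sum.neutral) (auto simp: False Dmat_entry)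
      ultimately show ?thesis by simp
    qed
    then have "A = P + Q" by (simp add: vec_eq_iff)
    moreover have "P \<in> L"
      unfolding P_def using full subspace_0[OF subspace]
      by (intro subspace_sum[OF subspace]) (auto intro!: subspace_scale[OF subspace] simp: full_def)
    moreover have "Q \<in> L"
      unfolding Q_def by (intro subspace_sum[OF subspace] subspace_scale[OF subspace] D)
    ultimately show "A \<in> L" using subspace_add[OF subspace] by simp
  qed
qed

end

section \<open>The Lie algebra of the system\<close>

lemma generic_combination:
  fixes As :: "'n::finite cmat set"
  assumes "finite As"
  shows "\<exists>l. (\<forall>A\<in>As. l A \<noteq> 0) \<and>
    (\<forall>a b. (\<exists>A\<in>As. A $ a $ b \<noteq> 0) \<longrightarrow> (\<Sum>A\<in>As. l A *\<^sub>R A) $ a $ b \<noteq> (0::complex))"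
  using assms
proof induction
  case empty
  then show ?case by simp
next
  case (insert A As)
  then obtain l where l: "\<forall>A\<in>As. l A \<noteq> 0"
    "\<And>a b. \<exists>A\<in>As. A $ a $ b \<noteq> 0 \<Longrightarrow> (\<Sum>A\<in>As. l A *\<^sub>R A) $ a $ b \<noteq> 0"
    by blast
  define S where "S = (\<Sum>A\<in>As. l A *\<^sub>R A)"
  \<comment> \<open>Each entry forbids at most one real coefficient for \<open>A\<close>. Where the
    entry of \<open>A\<close> is zero, the quotient is 0 by convention, a value excluded
    anyway.\<close>
  let ?bad = "(\<lambda>(a, b). Re (- S $ a $ b / A $ a $ b)) ` UNIV"
  have "finite (insert 0 ?bad)" by simp
  then have "\<exists>x. x \<notin> insert 0 ?bad" by (rule ex_new_if_finite[OF infinite_UNIV_char_0])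
  then obtain x :: real where x: "x \<notin> insert 0 ?bad" ..
  define l' where "l' = l(A := x)"
  have eq: "(\<Sum>A\<in>insert A As. l' A *\<^sub>R A) = x *\<^sub>R A + S"
    using insert.hyps unfolding S_def l'_def
    by (simp add: sum.insert) (intro sum.cong, auto)
  have "(x *\<^sub>R A + S) $ a $ b \<noteq> 0" if "\<exists>A'\<in>insert A As. A' $ a $ b \<noteq> 0" for a b
  proof (cases "A $ a $ b = 0")
    case True
    then show ?thesis using l(2)[of a b] that by (auto simp: S_def)
  next
    case False
    show ?thesis
    proof
      assume "(x *\<^sub>R A + S) $ a $ b = 0"
      then have "of_real x * A $ a $ b = - S $ a $ b"
        by (simp add: scaleR_conv_of_real[where 'a=complex] add_eq_0_iff2)
      then have "of_real x = - S $ a $ b / A $ a $ b"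
        using False by (simp add: field_simps)
      then have "x = Re (- S $ a $ b / A $ a $ b)"
        by (metis Re_complex_of_real)
      then show False using x by auto
    qed
  qed
  then have "\<forall>a b. (\<exists>A'\<in>insert A As. A' $ a $ b \<noteq> 0) \<longrightarrow> (\<Sum>A\<in>insert A As. l' A *\<^sub>R A) $ a $ b \<noteq> 0"
    unfolding eq by blast
  moreover have "\<forall>A'\<in>insert A As. l' A' \<noteq> 0"
    using l(1) x by (auto simp: l'_def)
  ultimately show ?case by blast
qed

section \<open>Walks, edges and their colours\<close>

lemma adj_rel_sym: "(u, v) \<in> adj_rel E \<Longrightarrow> (v, u) \<in> adj_rel E"
  unfolding adj_rel_def by (simp add: insert_commute[of u v])

lemma rtrancl_adj_rel_sym: "(u, v) \<in> (adj_rel E)\<^sup>* \<Longrightarrow> (v, u) \<in> (adj_rel E)\<^sup>*"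
  by (rule symD[OF sym_rtrancl[OF symI[OF adj_rel_sym]]])

text \<open>\<open>red\<close> is a cocycle with values modulo 2, so its sum along a walk telescopes
  to a value depending only on the two ends.\<close>

lemma walk_parity:
  assumes coc: "\<And>u v w. red u w = (red u v \<noteq> red v w)"
    and edge: "\<And>u v c. ({u, v}, c) \<in> E \<Longrightarrow> red u v \<longleftrightarrow> c = Red"
    and w: "is_walk E w" "w \<noteq> []"
  shows "odd (num_red w) \<longleftrightarrow> red (fst (hd w)) (snd (snd (last w)))"
  using w(2,1)
proof (induction w rule: list_nonempty_induct)
  case (single s)
  obtain u e v where s: "s = (u, e, v)" by (metis prod_cases3)
  then have "e \<in> E" "fst e = {u, v}" using single by (auto simp: is_walk_def)
  then have "red u v \<longleftrightarrow> snd e = Red" by (intro edge) (metis prod.collapse)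
  then show ?case by (simp add: num_red_def s)
next
  case (cons s w)
  obtain u e v where s: "s = (u, e, v)" by (metis prod_cases3)
  then have "e \<in> E" "fst e = {u, v}" using cons.prems by (auto simp: is_walk_def)
  then have r: "red u v \<longleftrightarrow> snd e = Red" by (intro edge) (metis prod.collapse)
  have "is_walk E w"
    using cons.prems unfolding is_walk_def by (auto dest: spec[of _ "Suc _"])
  moreover have "v = fst (hd w)"
    using cons.prems cons.hyps unfolding is_walk_def
    by (auto simp: s hd_conv_nth dest: spec[of _ 0])
  ultimately show ?case
    using cons.IH cons.hyps coc[of u "snd (snd (last w))" v] r by (auto simp: num_red_def s)
qed

lemma contr_edge_cases:
  fixes S1 S2 S3 :: "('n::{finite,linorder}) cmat set"
  assumes "({u, v}, c) \<in> contr_edges S1 S2 S3"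
  obtains (loop) i j where "i < j" "Dmat i j \<in> S3" "u = v" "c = Green"
  | (blue) i j where "i < j" "{i, j} = {u, v}" "u \<noteq> v" "skew_unit 1 i j \<in> S1" "c = Blue"
  | (red) i j where "i < j" "{i, j} = {u, v}" "u \<noteq> v" "skew_unit \<i> i j \<in> S2" "c = Red"
proof -
  have ne: "u \<noteq> v" if "{u, v} = {i, j}" "i < j" for i j
    using that by auto
  from assms consider
      i j where "{u, v} = {i, j}" "c = Blue" "i < j" "Bmat i j \<in> S1"
    | i j where "{u, v} = {i, j}" "c = Red" "i < j" "Cmat i j \<in> S2"
    | i j where "{u, v} = {i} \<or> {u, v} = {j}" "c = Green" "i < j" "Dmat i j \<in> S3"
    unfolding contr_edges_def by blast
  then show thesis
  proof cases
    case 1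
    then show thesis using blue[of i j] ne Bmat_eq_skew_unit[of i j] by auto
  next
    case 2
    then show thesis using red[of i j] ne Cmat_eq_skew_unit[of i j] by auto
  next
    case 3
    then show thesis using loop[of i j] by auto
  qed
qed

lemma drift_edge_cases:
  assumes "({u, v}, c) \<in> drift_edges As"
  obtains (loop) A where "u = v" "A \<in> As" "A $ u $ u \<noteq> 0"
  | (blue) A where "u \<noteq> v" "A \<in> As" "Re (A $ u $ v) \<noteq> 0" "c = Blue"
  | (red) A where "u \<noteq> v" "A \<in> As" "Im (A $ u $ v) \<noteq> 0" "c = Red"
proof -
  from assms have "({u, v}, c) \<in> {({i, j}, Blue) | i j. i \<noteq> j \<and> (\<exists>A\<in>As. Re (A $ i $ j) = - Re (A $ j $ i) \<and> Re (A $ i $ j) \<noteq> 0)} \<or>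
    ({u, v}, c) \<in> {({i, j}, Red) | i j. i \<noteq> j \<and> (\<exists>A\<in>As. Im (A $ i $ j) = Im (A $ j $ i) \<and> Im (A $ i $ j) \<noteq> 0)} \<or>
    ({u, v}, c) \<in> {({i}, Green) | i. \<exists>A\<in>As. A $ i $ i \<noteq> 0}" (is "?B \<or> ?R \<or> ?G")
    unfolding drift_edges_def Un_iff by simp
  then consider ?B | ?R | ?G by argo
  then show thesis
  proof cases
    case 1
    then obtain i j A where "{u, v} = {i, j}" "c = Blue" "i \<noteq> j" "A \<in> As"
        "Re (A $ i $ j) = - Re (A $ j $ i)" "Re (A $ i $ j) \<noteq> 0" by auto
    then show thesis using blue[of A] by (auto simp: doubleton_eq_iff)
  next
    case 2
    then obtain i j A where "{u, v} = {i, j}" "c = Red" "i \<noteq> j" "A \<in> As"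
        "Im (A $ i $ j) = Im (A $ j $ i)" "Im (A $ i $ j) \<noteq> 0" by auto
    then show thesis using red[of A] by (auto simp: doubleton_eq_iff)
  next
    case 3
    then obtain A where "u = v" "A \<in> As" "A $ u $ u \<noteq> 0" by auto
    then show thesis using loop[of A] by auto
  qed
qed

text \<open>Edges collect contributions of all drift matrices, so a multi-edge arises even when the
  real and the imaginary entry come from different matrices. Hence every real combination has its
  entry on one fixed axis.\<close>

lemma drift_axis:
  assumes su: "As \<subseteq> su" and nm: "\<not> has_multi_edge (drift_edges As)" and ab: "a \<noteq> b"
  shows "(\<forall>A\<in>As. Re (A $ a $ b) = 0) \<or> (\<forall>A\<in>As. Im (A $ a $ b) = 0)"
proof (rule ccontr)
  assume "\<not> ?thesis"
  then obtain A A' where A: "A \<in> As" "Re (A $ a $ b) \<noteq> 0" and A': "A' \<in> As" "Im (A' $ a $ b) \<noteq> 0"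
    by blast
  have skew: "cnj (X $ l $ k) = - X $ k $ l" if "X \<in> As" for X :: "'a cmat" and k l
    using that su by (auto simp: su_def adjoint_mat_def vec_eq_iff)
  have "Re (A $ a $ b) = - Re (A $ b $ a)" "Im (A' $ a $ b) = Im (A' $ b $ a)"
    using arg_cong[OF skew[OF A(1), of b a], of Re] arg_cong[OF skew[OF A'(1), of b a], of Im]
    by simp_all
  then have "({a, b}, Blue) \<in> drift_edges As" "({a, b}, Red) \<in> drift_edges As"
    unfolding drift_edges_def using A A' ab by blast+
  then show False using nm unfolding has_multi_edge_def by blast
qed

text \<open>Only the single combination \<open>B0\<close> is known to lie in \<open>L\<close>, not
  the separate drift matrices; genericity ensures that it still displays every drift edge.\<close>

lemma su_subset_lie_algebra:
  fixes As S1 S2 S3 L :: "('n::{finite,linorder}) cmat set" and l :: "'n cmat \<Rightarrow> real"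
  defines "B0 \<equiv> (\<Sum>A\<in>As. l A *\<^sub>R A)" and "E \<equiv> drift_edges As \<union> contr_edges S1 S2 S3"
  assumes "lie_algebra L" and B0: "B0 \<in> L" and S: "S1 \<union> S2 \<union> S3 \<subseteq> L"
    and As_su: "As \<subseteq> su"
    and generic: "\<And>a b. \<exists>A\<in>As. A $ a $ b \<noteq> 0 \<Longrightarrow> B0 $ a $ b \<noteq> 0"
    and comps: "\<forall>K\<in>components (contr_edges S1 S2 S3). card K \<ge> 3"
    and multi: "\<not> has_multi_edge (drift_edges As)"
    and conn: "graph_connected E"
    and cyc: "has_self_loop E \<or> (\<exists>w. is_cycle E w \<and> odd (num_red w))"
  shows "su \<subseteq> L"
proof -
  interpret lie_algebra L by fact
  let ?C = "contr_edges S1 S2 S3"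
  have B0_su: "B0 \<in> su"
    unfolding B0_def using As_su by (intro subspace_sum[OF subspace_su] subspace_scale[OF subspace_su]) auto
  then have B0_skew: "adjoint_mat B0 = - B0" and B0_tr: "mtrace B0 = 0" by (auto simp: su_def)
  have B0_axis: "Re (B0 $ a $ b) = 0 \<or> Im (B0 $ a $ b) = 0" if "a \<noteq> b" for a b
    using drift_axis[OF As_su multi that] by (auto simp: B0_def intro!: sum.neutral)
  \<comment> \<open>An entry on one axis is a real multiple of \<open>1\<close> or
    \<open>\<i>\<close>, so an isolated entry yields B or C by real scaling alone.\<close>
  have axis_unit: "skew_unit (if Re z = 0 then \<i> else 1) a b \<in> L"
    if "skew_unit z a b \<in> L" "z \<noteq> 0" "Re z = 0 \<or> Im z = 0" for z a b
  proof -
    define r where "r = (if Re z = 0 then Im z else Re z)"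
    have "z = of_real r * (if Re z = 0 then \<i> else 1)" "r \<noteq> 0"
      using that(2,3) by (auto simp: r_def complex_eq_iff)
    then show ?thesis using that(1) skew_unit_scale_iff by metis
  qed
  have contr_linked: "linked u v" if "({u, v}, c) \<in> ?C" "u \<noteq> v" for u v c
    using that(1)
  proof (cases rule: contr_edge_cases)
    case (blue i j)
    then have "linked i j" using S by (auto simp: linked_def)
    then show ?thesis using blue(2) linked_sym by (auto simp: doubleton_eq_iff)
  next
    case (red i j)
    then have "linked i j" using S by (auto simp: linked_def)
    then show ?thesis using red(2) linked_sym by (auto simp: doubleton_eq_iff)
  qed (use that in simp)
  have comp_linked: "u = v \<or> linked u v" if "(u, v) \<in> (adj_rel ?C)\<^sup>*" for u v
    using that
  proof induction
    case (step v w)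
    then obtain c where "({v, w}, c) \<in> ?C" by (auto simp: adj_rel_def)
    then have "v = w \<or> linked v w" using contr_linked by blast
    then show ?case using step.IH linked_trans by blast
  qed simp
  have third: "\<exists>b c. distinct [u, b, c] \<and> (u, b) \<in> (adj_rel ?C)\<^sup>* \<and> (u, c) \<in> (adj_rel ?C)\<^sup>*" for u
  proof -
    let ?K = "{v. (u, v) \<in> (adj_rel ?C)\<^sup>*}"
    have "card ?K \<ge> 3" using comps by (auto simp: components_def)
    then have "card (?K - {u}) \<ge> 2" by simp
    then obtain b where b: "b \<in> ?K - {u}"
      by (metis card.empty ex_in_conv not_numeral_le_zero)
    then have "card (?K - {u} - {b}) \<ge> 1" using \<open>card (?K - {u}) \<ge> 2\<close> by simp
    then obtain c where "c \<in> ?K - {u} - {b}"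
      by (metis card.empty ex_in_conv not_one_le_zero)
    then show ?thesis using b by auto
  qed
  have linked: "linked u v" if "u \<noteq> v" for u v
  proof -
    \<comment> \<open>Only a drift edge joining different control components needs work. The triples
      of nodes around its two ends are then disjoint, as the isolation of an entry requires.\<close>
    have edge: "u = v \<or> linked u v" if uv: "(u, v) \<in> adj_rel E" for u v
    proof (cases "u = v \<or> (u, v) \<in> (adj_rel ?C)\<^sup>*")
      case True
      then show ?thesis using comp_linked by blast
    next
      case False
      then have "u \<noteq> v" by simp
      from uv obtain c where "({u, v}, c) \<in> E" by (auto simp: adj_rel_def)
      moreover have "({u, v}, c) \<notin> ?C" using False by (auto simp: adj_rel_def)
      ultimately have "({u, v}, c) \<in> drift_edges As" by (simp add: E_def)
      then have "\<exists>A\<in>As. A $ u $ v \<noteq> 0"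
        using \<open>u \<noteq> v\<close> by (cases rule: drift_edge_cases) (auto intro!: bexI simp: complex_eq_iff)
      then have nz: "B0 $ u $ v \<noteq> 0" by (rule generic)
      obtain b c where bc: "distinct [u, b, c]" "(u, b) \<in> (adj_rel ?C)\<^sup>*" "(u, c) \<in> (adj_rel ?C)\<^sup>*"
        using third by blast
      obtain b' c' where bc': "distinct [v, b', c']" "(v, b') \<in> (adj_rel ?C)\<^sup>*" "(v, c') \<in> (adj_rel ?C)\<^sup>*"
        using third by blast
      have "x \<noteq> y" if "(u, x) \<in> (adj_rel ?C)\<^sup>*" "(v, y) \<in> (adj_rel ?C)\<^sup>*" for x y
        using that False by (meson rtrancl_adj_rel_sym rtrancl_trans)
      then have "distinct [u, b, c, v, b', c']"
        using bc bc' by (simp; metis rtrancl.rtrancl_refl)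
      moreover have "linked u b" "linked u c" "linked v b'" "linked v c'"
        using bc bc' comp_linked by auto
      ultimately have "skew_unit (B0 $ u $ v) u v \<in> L"
        using isolate_entry B0 B0_skew by blast
      from axis_unit[OF this nz B0_axis[OF \<open>u \<noteq> v\<close>]] show ?thesis
        using \<open>u \<noteq> v\<close> by (auto simp: linked_def split: if_splits)
    qed
    have "(u, v) \<in> (adj_rel E)\<^sup>*" using conn by (simp add: graph_connected_def)
    then have "u = v \<or> linked u v"
    proof induction
      case (step v w)
      then show ?case using edge linked_trans by blast
    qed simp
    then show ?thesis using that by simp
  qed
  have "\<exists>a b. full a b"
  proof (rule ccontr)
    assume nf: "\<nexists>a b. full a b"
    have aligned: "Im (cnj e * B0 $ a $ b) = 0" "Im (B0 $ a $ a) = Im (B0 $ b $ b)"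
      if "a \<noteq> b" "e = 1 \<or> e = \<i>" "skew_unit e a b \<in> L" for a b e
      using full_or_aligned[OF linked[OF that(1)] that(2,3) B0 B0_skew] nf by auto
    \<comment> \<open>All pairs are linked, so alignment makes the diagonal constant, and the zero
      trace makes it vanish.\<close>
    have diag: "B0 $ a $ a = 0" for a
    proof -
      have Im_eq: "Im (B0 $ b $ b) = Im (B0 $ a $ a)" for b
        using aligned(2)[of b a] linked_unit[OF linked[of b a]] by metis
      have "Im (mtrace B0) = (\<Sum>k\<in>(UNIV :: 'n set). Im (B0 $ a $ a))"
        unfolding mtrace_def Im_sum by (intro sum.cong refl Im_eq)
      then have "Im (B0 $ a $ a) = 0" using B0_tr by simp
      moreover have "cnj (B0 $ a $ a) = - B0 $ a $ a"
        using B0_skew by (auto simp: adjoint_mat_def vec_eq_iff)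
      then have "Re (B0 $ a $ a) = 0" by (simp add: complex_eq_iff)
      ultimately show ?thesis by (simp add: complex_eq_iff)
    qed
    \<comment> \<open>With every pair linked and none full, exactly one of the two units lies in
      \<open>L\<close>; \<open>red\<close> records which one, for all pairs and not just for
      edges.\<close>
    define red where "red u v \<longleftrightarrow> u \<noteq> v \<and> skew_unit \<i> u v \<in> L" for u v
    have not_red: "skew_unit 1 u v \<in> L \<longleftrightarrow> \<not> red u v" if "u \<noteq> v" for u v
      using linked[OF that] nf fullI[OF that] that by (auto simp: red_def linked_def)
    have red_sym: "red u v \<longleftrightarrow> red v u" for u v
      using skew_unit_cnj_swap[of \<i> u v] skew_unit_cnj_swap[of \<i> v u]
      by (auto simp: red_def skew_unit_uminus)
    have coc: "red u w = (red u v \<noteq> red v w)" for u v w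
    proof (cases "u = v \<or> v = w \<or> u = w")
      case True
      then show ?thesis using red_sym by (auto simp: red_def)
    next
      case False
      define d where "d x y = (if red x y then \<i> else 1)" for x y
      have dL: "skew_unit (d x y) x y \<in> L" if "x \<noteq> y" for x y
        using not_red[OF that] by (auto simp: d_def red_def)
      have "skew_unit (d u v * d v w) u w \<in> L"
        using False by (intro skew_unit_trans[of _ u v] dL) auto
      then show ?thesis
        using not_red[of u w] False skew_unit_uminus[of 1 u w]
        by (auto simp: d_def split: if_splits) (auto simp: red_def)
    qed
    \<comment> \<open>A drift loop would give \<open>B0\<close> a nonzero diagonal entry; a control
      loop would put some \<open>Dmat i j\<close> into \<open>L\<close> and make that pair
      full.\<close>
    have no_loop: "({u}, c) \<notin> E" for u c
    proof
      assume "({u}, c) \<in> E"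
      then consider "({u, u}, c) \<in> drift_edges As" | "({u, u}, c) \<in> ?C" by (auto simp: E_def)
      then show False
      proof cases
        case 1
        then show False
        proof (cases rule: drift_edge_cases)
          case (loop A)
          then show False using generic[of u u] diag by blast
        qed auto
      next
        case 2
        then show False
        proof (cases rule: contr_edge_cases)
          case (loop i j)
          then have "full i j" using S linked[of i j] by (intro full_if_Dmat) auto
          then show False using nf by blast
        qed auto
      qed
    qed
    have edge: "red u v \<longleftrightarrow> c = Red" if uv: "({u, v}, c) \<in> E" for u v c
    proof -
      have "u \<noteq> v" using no_loop uv by auto
      from uv consider "({u, v}, c) \<in> drift_edges As" | "({u, v}, c) \<in> ?C" by (auto simp: E_def)
      then show ?thesis
      proof cases
        case 1
        have nz: "B0 $ u $ v \<noteq> 0" if "A \<in> As" "A $ u $ v \<noteq> 0" for A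
          using generic that by blast
        \<comment> \<open>Alignment constrains every entry of \<open>B0\<close>, including those
          inside a control component, where the isolation by two disjoint triples does not
          apply.\<close>
        have re: "Im (B0 $ u $ v) = 0" if "\<not> red u v"
          using aligned(1)[OF \<open>u \<noteq> v\<close>, of 1] not_red[OF \<open>u \<noteq> v\<close>] that by simp
        have im: "Re (B0 $ u $ v) = 0" if "red u v"
          using aligned(1)[OF \<open>u \<noteq> v\<close>, of \<i>] that by (simp add: red_def)
        show ?thesis
          using 1
        proof (cases rule: drift_edge_cases)
          case (blue A)
          then have "\<forall>A\<in>As. Im (A $ u $ v) = 0"
            using drift_axis[OF As_su multi \<open>u \<noteq> v\<close>] by blast
          then have "Im (B0 $ u $ v) = 0" by (simp add: B0_def)
          moreover have "B0 $ u $ v \<noteq> 0" using blue nz by fastforce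
          ultimately show ?thesis using im blue by (auto simp: complex_eq_iff)
        next
          case (red A)
          then have "\<forall>A\<in>As. Re (A $ u $ v) = 0"
            using drift_axis[OF As_su multi \<open>u \<noteq> v\<close>] by blast
          then have "Re (B0 $ u $ v) = 0" by (simp add: B0_def)
          moreover have "B0 $ u $ v \<noteq> 0" using red nz by fastforce
          ultimately show ?thesis using re red by (auto simp: complex_eq_iff)
        qed (use \<open>u \<noteq> v\<close> in simp)
      next
        case 2
        then show ?thesis
        proof (cases rule: contr_edge_cases)
          case (blue i j)
          then have "\<not> red i j" using S not_red[of i j] by auto
          then show ?thesis using blue red_sym by (auto simp: doubleton_eq_iff)
        next
          case (red i j)
          then have "red i j" using S by (auto simp: red_def)
          then show ?thesis using red red_sym by (auto simp: doubleton_eq_iff)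
        qed (use \<open>u \<noteq> v\<close> in simp)
      qed
    qed
    have "even (num_red w)" if "is_cycle E w" for w
      using walk_parity[of red E w, OF coc edge] that by (auto simp: is_cycle_def red_def)
    moreover have "\<not> has_self_loop E" using no_loop by (auto simp: has_self_loop_def)
    ultimately show False using cyc by blast
  qed
  then show ?thesis using su_subset_if_full linked by blast
qed

section \<open>Closed submonoids of the special unitary group\<close>

lemma has_vector_derivative_sequence:
  fixes f :: "real \<Rightarrow> 'a::real_normed_vector"
  assumes "(f has_vector_derivative D) (at 0)"
  shows "(\<lambda>k. real (Suc k) *\<^sub>R (f (1 / real (Suc k)) - f 0)) \<longlonglongrightarrow> D"
proof -
  have lim: "((\<lambda>h. norm (f h - f 0 - h *\<^sub>R D) / norm h) \<longlongrightarrow> 0) (at 0)"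
    using assms unfolding has_vector_derivative_def has_derivative_at by simp
  have "filterlim (\<lambda>k. 1 / real (Suc k)) (at 0) sequentially"
    unfolding filterlim_at using LIMSEQ_inverse_real_of_nat by (simp add: inverse_eq_divide)
  from filterlim_compose[OF lim this]
  have "(\<lambda>k. norm (real (Suc k) *\<^sub>R (f (1 / real (Suc k)) - f 0) - D)) \<longlonglongrightarrow> 0"
  proof (rule Lim_transform_eventually, intro always_eventually allI)
    fix k
    let ?n = "real (Suc k)"
    have "?n *\<^sub>R (f (1 / ?n) - f 0) - D = ?n *\<^sub>R (f (1 / ?n) - f 0 - (1 / ?n) *\<^sub>R D)"
      by (simp add: scaleR_diff_right)
    then show "norm (f (1 / ?n) - f 0 - (1 / ?n) *\<^sub>R D) / norm (1 / ?n)
        = norm (?n *\<^sub>R (f (1 / ?n) - f 0) - D)"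
      by (simp add: mult.commute)
  qed
  then show ?thesis by (simp add: tendsto_norm_zero_iff LIM_zero_iff)
qed

lemma conj_has_vector_derivative:
  "((\<lambda>t. mexp (t *\<^sub>R X) ** Y ** mexp (t *\<^sub>R (- X))) has_vector_derivative commutator X Y) (at 0)"
proof -
  have "((\<lambda>t. mexp (t *\<^sub>R X) ** Y ** mexp (t *\<^sub>R (- X))) has_vector_derivative
      (mexp (0 *\<^sub>R X) ** Y ** (- X ** mexp (0 *\<^sub>R (- X))) + X ** mexp (0 *\<^sub>R X) ** Y ** mexp (0 *\<^sub>R (- X)))) (at 0)"
    by (intro mm.has_vector_derivative mexp_has_vector_derivative
        bounded_linear.has_vector_derivative[OF mm.bounded_linear_left])
  then show ?thesis by (simp add: mm.minus_right)
qed

text \<open>The bracket is the derivative at 0 of the conjugation curve, and a subspace of finite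
  dimension is closed under limits of difference quotients.\<close>

lemma commutator_in_subspace:
  fixes V :: "'n::finite cmat set"
  assumes V: "subspace V" and conj: "\<And>t. mexp (t *\<^sub>R X) ** Y ** mexp (t *\<^sub>R (- X)) \<in> V"
  shows "commutator X Y \<in> V"
proof -
  define f where "f t = mexp (t *\<^sub>R X) ** Y ** mexp (t *\<^sub>R (- X))" for t
  have "real (Suc k) *\<^sub>R (f (1 / real (Suc k)) - f 0) \<in> V" for k
    using conj unfolding f_def by (intro subspace_scale[OF V] subspace_diff[OF V])
  moreover have "(\<lambda>k. real (Suc k) *\<^sub>R (f (1 / real (Suc k)) - f 0)) \<longlonglongrightarrow> commutator X Y"
    unfolding f_def by (rule has_vector_derivative_sequence[OF conj_has_vector_derivative])
  ultimately show ?thesis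
    using closed_sequentially[OF closed_subspace[OF V],
        of "\<lambda>k. real (Suc k) *\<^sub>R (f (1 / real (Suc k)) - f 0)"] by blast
qed

section \<open>Powers of unitary matrices\<close>

primrec mpow :: "'n::finite cmat \<Rightarrow> nat \<Rightarrow> 'n cmat" where
  "mpow A 0 = mat 1"
| "mpow A (Suc n) = A ** mpow A n"

lemma mpow_add: "mpow A (m + n) = mpow A m ** mpow A n"
  by (induction m) (simp_all add: matrix_mul_assoc)

lemma mpow_SU: "A \<in> SU \<Longrightarrow> mpow A n \<in> SU"
  by (induction n) (simp_all add: SU_mult)

lemma mpow_mexp: "mpow (mexp (s *\<^sub>R Z)) n = mexp ((real n * s) *\<^sub>R Z)"
proof (induction n)
  case (Suc n)
  then show ?case using mexp_add_scaleR[of s "real n * s" Z] by (simp add: algebra_simps)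
qed simp

text \<open>Telescoping: each factor exchanged costs one \<open>norm (A - B)\<close>, since the
  remaining factors are isometries.\<close>

lemma norm_mpow_diff:
  assumes "A \<in> SU" "B \<in> SU"
  shows "norm (mpow A n - mpow B n) \<le> real n * norm (A - B)"
proof (induction n)
  case (Suc n)
  have "mpow A (Suc n) - mpow B (Suc n) = A ** (mpow A n - mpow B n) + (A - B) ** mpow B n"
    by (simp add: mm.diff_left mm.diff_right)
  also have "norm \<dots> \<le> norm (A ** (mpow A n - mpow B n)) + norm ((A - B) ** mpow B n)"
    by (rule norm_triangle_ineq)
  also have "\<dots> = norm (mpow A n - mpow B n) + norm (A - B)"
    by (simp add: norm_SU_mult_left[OF assms(1)] norm_SU_mult_right[OF mpow_SU[OF assms(2)]])
  finally show ?case using Suc by (simp add: algebra_simps)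
qed simp

lemma mexp_minus_adjoint:
  assumes "Z \<in> su" shows "mexp (- Z) = adjoint_mat (mexp Z)"
proof -
  have "adjoint_mat (mexp Z) ** (mexp Z ** mexp (- Z)) = mexp (- Z)"
    unfolding matrix_mul_assoc SU_adjoint_left[OF mexp_in_SU[OF assms]] by simp
  then show ?thesis by (simp add: mexp_minus_right_inverse)
qed

section \<open>Inverses and tangent vectors of a closed submonoid\<close>

locale closed_SU_monoid =
  fixes H :: "'n::finite cmat set"
  assumes closed: "closed H" and subset_SU: "H \<subseteq> SU" and one: "mat 1 \<in> H"
    and mult: "X \<in> H \<Longrightarrow> Y \<in> H \<Longrightarrow> X ** Y \<in> H"
begin

lemma mpow_in: "g \<in> H \<Longrightarrow> mpow g n \<in> H"
  by (induction n) (simp_all add: one mult)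

text \<open>By compactness the powers of \<open>g\<close> have a convergent subsequence; two nearby
  powers show that some power is close to the inverse.\<close>

lemma adjoint_in:
  assumes g: "g \<in> H" shows "adjoint_mat g \<in> H"
proof -
  have gSU: "g \<in> SU" using g subset_SU by blast
  have "compact H"
    using compact_Int_closed[OF compact_SU closed] subset_SU by (simp add: Int_absorb1)
  then obtain L r where r: "strict_mono (r :: nat \<Rightarrow> nat)" "((\<lambda>n. mpow g n) \<circ> r) \<longlonglongrightarrow> L"
    using mpow_in[OF g] unfolding compact_def by metis
  have "Cauchy ((\<lambda>n. mpow g n) \<circ> r)" using r(2) by (intro convergent_Cauchy) (auto simp: convergent_def)
  have "adjoint_mat g \<in> closure H"
    unfolding closure_approachable
  proof (intro allI impI)
    fix \<epsilon> :: real assume "\<epsilon> > 0"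
    with \<open>Cauchy _\<close> obtain N where N: "\<And>m n. m \<ge> N \<Longrightarrow> n \<ge> N \<Longrightarrow> dist (mpow g (r m)) (mpow g (r n)) < \<epsilon>"
      unfolding Cauchy_def o_def by blast
    have "r N < r (Suc N)" using r(1) by (simp add: strict_mono_def)
    \<comment> \<open>The exponents differ by \<open>Suc p\<close>, so one factor \<open>g\<close>
      can be split off and \<open>mpow g p\<close> remains to approximate the inverse;
      \<open>p = 0\<close> is allowed.\<close>
    then obtain p where p: "r (Suc N) = r N + Suc p" using less_imp_Suc_add by auto
    have "mpow g (r (Suc N)) - mpow g (r N) = mpow g (r N) ** (g ** (mpow g p - adjoint_mat g))"
      unfolding p mpow_add by (simp add: mm.diff_right SU_adjoint_right[OF gSU])
    then have "norm (mpow g (r (Suc N)) - mpow g (r N)) = norm (mpow g p - adjoint_mat g)"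
      by (simp add: norm_SU_mult_left gSU mpow_SU)
    then have "dist (mpow g p) (adjoint_mat g) < \<epsilon>"
      using N[of "Suc N" N] unfolding dist_norm by simp
    then show "\<exists>y\<in>H. dist y (adjoint_mat g) < \<epsilon>" using mpow_in[OF g] by blast
  qed
  then show ?thesis using closed by simp
qed

text \<open>To first order \<open>g k\<close> agrees with the exponential of
  \<open>Z / (k + 1)\<close>. Raising both to the power \<open>k + 1\<close> multiplies the error by
  at most \<open>k + 1\<close>, and it still tends to 0.\<close>

lemma mexp_limit_in:
  assumes g: "\<And>k. g k \<in> H" and Z: "Z \<in> su"
    and lim: "(\<lambda>k. real (Suc k) *\<^sub>R (g k - mat 1)) \<longlonglongrightarrow> Z"
  shows "mexp Z \<in> H"
proof -
  define E where "E k = mexp ((1 / real (Suc k)) *\<^sub>R Z)" for k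
  have ESU: "E k \<in> SU" for k
    unfolding E_def by (intro mexp_in_SU subspace_scale[OF subspace_su] Z)
  have "(\<lambda>k. real (Suc k) *\<^sub>R (E k - mexp (0 *\<^sub>R Z))) \<longlonglongrightarrow> Z ** mexp (0 *\<^sub>R Z)"
    unfolding E_def by (rule has_vector_derivative_sequence[OF mexp_has_vector_derivative])
  then have "(\<lambda>k. real (Suc k) *\<^sub>R (g k - mat 1) - real (Suc k) *\<^sub>R (E k - mat 1)) \<longlonglongrightarrow> Z - Z"
    using lim by (intro tendsto_diff) simp_all
  then have "(\<lambda>k. real (Suc k) *\<^sub>R (g k - E k)) \<longlonglongrightarrow> 0"
    by (simp flip: scaleR_diff_right)
  then have lim0: "(\<lambda>k. norm (real (Suc k) *\<^sub>R (g k - E k))) \<longlonglongrightarrow> 0"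
    by (rule tendsto_norm_zero)
  have le: "norm (mpow (g k) (Suc k) - mexp Z) \<le> norm (real (Suc k) *\<^sub>R (g k - E k))" for k
  proof -
    have "mpow (E k) (Suc k) = mexp Z" unfolding E_def mpow_mexp by simp
    then show ?thesis
      using norm_mpow_diff[of "g k" "E k" "Suc k"] g subset_SU ESU by auto
  qed
  have "(\<lambda>k. mpow (g k) (Suc k) - mexp Z) \<longlonglongrightarrow> 0"
    by (rule Lim_null_comparison[OF always_eventually[OF allI[OF le]] lim0])
  then have "(\<lambda>k. mpow (g k) (Suc k)) \<longlonglongrightarrow> mexp Z" by (rule LIM_zero_cancel)
  then show ?thesis using closed_sequentially[OF closed, of "\<lambda>k. mpow (g k) (Suc k)"] mpow_in[OF g] by blast
qed

definition tangent :: "'n cmat set" where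
  "tangent = {Z \<in> su. \<forall>t. mexp (t *\<^sub>R Z) \<in> H}"

text \<open>Closure under sums is the Lie product formula: products of short exponentials of
  \<open>X\<close> and \<open>Y\<close> have velocity \<open>X + Y\<close>.\<close>

lemma subspace_tangent: "subspace tangent"
  unfolding subspace_def
proof (intro conjI ballI allI)
  show "0 \<in> tangent"
    using subspace_0[OF subspace_su] one by (simp add: tangent_def)
next
  fix X Y assume X: "X \<in> tangent" and Y: "Y \<in> tangent"
  have "mexp (t *\<^sub>R (X + Y)) \<in> H" for t
  proof (rule mexp_limit_in)
    define f where "f s = mexp (s *\<^sub>R (t *\<^sub>R X)) ** mexp (s *\<^sub>R (t *\<^sub>R Y))" for s
    show "f (1 / real (Suc k)) \<in> H" for k
      using X Y unfolding f_def tangent_def scaleR_scaleR by (intro mult) auto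
    show "t *\<^sub>R (X + Y) \<in> su"
      using X Y by (intro subspace_scale[OF subspace_su] subspace_add[OF subspace_su]) (auto simp: tangent_def)
    have "(f has_vector_derivative (mexp (0 *\<^sub>R (t *\<^sub>R X)) ** (t *\<^sub>R Y ** mexp (0 *\<^sub>R (t *\<^sub>R Y)))
        + t *\<^sub>R X ** mexp (0 *\<^sub>R (t *\<^sub>R X)) ** mexp (0 *\<^sub>R (t *\<^sub>R Y)))) (at 0)"
      unfolding f_def by (intro mm.has_vector_derivative mexp_has_vector_derivative)
    then have "(f has_vector_derivative t *\<^sub>R (X + Y)) (at 0)"
      by (simp add: algebra_simps)
    from has_vector_derivative_sequence[OF this]
    show "(\<lambda>k. real (Suc k) *\<^sub>R (f (1 / real (Suc k)) - mat 1)) \<longlonglongrightarrow> t *\<^sub>R (X + Y)"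
      by (simp add: f_def)
  qed
  then show "X + Y \<in> tangent"
    using X Y by (auto simp: tangent_def intro: subspace_add[OF subspace_su])
next
  fix c X assume "X \<in> tangent"
  then show "c *\<^sub>R X \<in> tangent"
    by (auto simp: tangent_def intro: subspace_scale[OF subspace_su])
qed

lemma tangent_conj:
  assumes "U \<in> H" "X \<in> tangent"
  shows "U ** X ** adjoint_mat U \<in> tangent"
proof -
  have U: "U \<in> SU" using assms subset_SU by blast
  have "mexp (t *\<^sub>R (U ** X ** adjoint_mat U)) \<in> H" for t
    unfolding mexp_conj[OF SU_adjoint_right[OF U], symmetric]
    using assms by (intro mult adjoint_in) (auto simp: tangent_def)
  then show ?thesis using assms su_conj[OF U] by (simp add: tangent_def)
qed

lemma lie_algebra_tangent: "lie_algebra tangent"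
proof
  show "subspace tangent" by (rule subspace_tangent)
next
  fix X Y assume X: "X \<in> tangent" and Y: "Y \<in> tangent"
  show "commutator X Y \<in> tangent"
  proof (rule commutator_in_subspace[OF subspace_tangent])
    fix t
    have "t *\<^sub>R X \<in> su" "mexp (t *\<^sub>R X) \<in> H"
      using X subspace_scale[OF subspace_su] by (auto simp: tangent_def)
    then show "mexp (t *\<^sub>R X) ** Y ** mexp (t *\<^sub>R (- X)) \<in> tangent"
      using tangent_conj[OF _ Y] mexp_minus_adjoint[of "t *\<^sub>R X"] by simp
  qed
qed

end

section \<open>Generation by two-level matrices\<close>

text \<open>For distinct \<open>a\<close>, \<open>b\<close> and unit
  \<open>(\<alpha>, \<beta>)\<close>, the general element of SU(2) acting on coordinates
  \<open>a\<close> and \<open>b\<close>.\<close>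

definition givens :: "complex \<Rightarrow> complex \<Rightarrow> 'n::finite \<Rightarrow> 'n \<Rightarrow> 'n cmat" where
  "givens \<alpha> \<beta> a b = (\<chi> k l. if k = a then (if l = a then \<alpha> else if l = b then \<beta> else 0)
     else if k = b then (if l = a then - cnj \<beta> else if l = b then cnj \<alpha> else 0)
     else if k = l then 1 else 0)"

lemma sum_two_points:
  fixes f :: "'n::finite \<Rightarrow> complex"
  assumes "a \<noteq> b" "\<And>m. m \<noteq> a \<Longrightarrow> m \<noteq> b \<Longrightarrow> f m = 0"
  shows "(\<Sum>m\<in>UNIV. f m) = f a + f b"
proof -
  have "(\<Sum>m\<in>UNIV. f m) = (\<Sum>m\<in>{a, b}. f m)"
    using assms(2) by (intro sum.mono_neutral_right) auto
  then show ?thesis using assms(1) by simp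
qed

lemma givens_mult_entry:
  fixes X :: "'n::finite cmat"
  assumes "a \<noteq> b"
  shows "(givens \<alpha> \<beta> a b ** X) $ k $ l =
    (if k = a then \<alpha> * X $ a $ l + \<beta> * X $ b $ l
     else if k = b then - cnj \<beta> * X $ a $ l + cnj \<alpha> * X $ b $ l else X $ k $ l)"
proof (cases "k = a \<or> k = b")
  case True
  have "(givens \<alpha> \<beta> a b ** X) $ k $ l =
      givens \<alpha> \<beta> a b $ k $ a * X $ a $ l + givens \<alpha> \<beta> a b $ k $ b * X $ b $ l"
    unfolding matrix_matrix_mult_def vec_lambda_beta
    by (rule sum_two_points[OF assms]) (use True in \<open>auto simp: givens_def\<close>)
  then show ?thesis using True assms by (auto simp: givens_def)
next
  case False
  have "(givens \<alpha> \<beta> a b ** X) $ k $ l = (\<Sum>m\<in>UNIV. if m = k then X $ k $ l else 0)"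
    unfolding matrix_matrix_mult_def vec_lambda_beta
    by (rule sum.cong) (use False in \<open>auto simp: givens_def\<close>)
  then show ?thesis using False by simp
qed

text \<open>The general element of the copy of su(2) on coordinates \<open>a\<close> and
  \<open>b\<close>.\<close>

definition two_level :: "real \<Rightarrow> complex \<Rightarrow> 'n::finite \<Rightarrow> 'n \<Rightarrow> 'n cmat" where
  "two_level x z a b = (\<chi> k l. if k = a then (if l = a then \<i> * of_real x else if l = b then z else 0)
     else if k = b then (if l = a then - cnj z else if l = b then - \<i> * of_real x else 0) else 0)"

lemma two_level_mult_entry:
  fixes X :: "'n::finite cmat"
  assumes "a \<noteq> b"
  shows "(two_level x z a b ** X) $ k $ l =
    (if k = a then \<i> * of_real x * X $ a $ l + z * X $ b $ l
     else if k = b then - cnj z * X $ a $ l - \<i> * of_real x * X $ b $ l else 0)"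
proof -
  have "(two_level x z a b ** X) $ k $ l =
      two_level x z a b $ k $ a * X $ a $ l + two_level x z a b $ k $ b * X $ b $ l"
    unfolding matrix_matrix_mult_def vec_lambda_beta
    by (rule sum_two_points[OF assms]) (auto simp: two_level_def)
  then show ?thesis using assms by (auto simp: two_level_def)
qed

lemma two_level_in_su:
  assumes "a \<noteq> b" shows "two_level x z a b \<in> su"
proof -
  have "mtrace (two_level x z a b) = two_level x z a b $ a $ a + two_level x z a b $ b $ b"
    unfolding mtrace_def by (rule sum_two_points[OF assms]) (auto simp: two_level_def)
  also have "\<dots> = 0" using assms by (auto simp: two_level_def)
  finally show ?thesis
    using assms by (auto simp: su_def adjoint_mat_def vec_eq_iff two_level_def)
qed

text \<open>A normalised generator squares to minus the projection onto the two coordinates, so a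
  Rodrigues formula in \<open>cos t\<close> and \<open>sin t\<close> solves the defining
  equation.\<close>

lemma mexp_two_level:
  assumes ab: "a \<noteq> b" and unit: "z * cnj z + (of_real x)\<^sup>2 = 1"
  shows "mexp (t *\<^sub>R two_level x z a b) =
    givens (of_real (cos t) + \<i> * of_real x * of_real (sin t)) (z * of_real (sin t)) a b"
proof -
  define N where "N = two_level x z a b"
  define P where "P = (\<chi> k l. if (k = a \<or> k = b) \<and> k = l then (1 :: complex) else 0)"
  define R where "R t = mat 1 + (cos t - 1) *\<^sub>R P + sin t *\<^sub>R N" for t
  have NP: "N ** P = N"
    using ab unfolding vec_eq_iff N_def
    by (auto simp: two_level_mult_entry P_def) (auto simp: two_level_def)
  have sq: "z * cnj z = 1 - (of_real x)\<^sup>2" using unit by (simp add: algebra_simps)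
  have NN: "N ** N = - P"
  proof -
    have "(N ** N) $ k $ l = (- P) $ k $ l" for k l
      unfolding N_def two_level_mult_entry[OF ab] using ab sq
      by (auto simp: P_def two_level_def power2_eq_square algebra_simps)
    then show ?thesis by (simp add: vec_eq_iff)
  qed
  have R': "(R has_vector_derivative N ** R t) (at t)" for t
  proof -
    have "(R has_vector_derivative 0 + (- sin t) *\<^sub>R P + cos t *\<^sub>R N) (at t)"
      unfolding R_def
      by (intro has_vector_derivative_add has_vector_derivative_const
          bounded_linear.has_vector_derivative[OF bounded_linear_scaleR_left])
        (auto intro!: derivative_eq_intros simp flip: has_real_derivative_iff_has_vector_derivative)
    moreover have "N ** R t = 0 + (- sin t) *\<^sub>R P + cos t *\<^sub>R N"
      unfolding R_def mm.add_right mm.scaleR_right NP NN by (simp add: algebra_simps)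
    ultimately show ?thesis by simp
  qed
  have "mexp (t *\<^sub>R N) = R t"
    by (rule mexp_unique[symmetric, OF R']) (simp add: R_def)
  moreover have "R t $ k $ l =
    givens (of_real (cos t) + \<i> * of_real x * of_real (sin t)) (z * of_real (sin t)) a b $ k $ l" for k l
    unfolding R_def N_def vector_add_component vector_scaleR_component scaleR_conv_of_real[where 'a=complex]
    using ab by (auto simp: mat_def P_def two_level_def givens_def algebra_simps)
  ultimately show ?thesis by (simp add: vec_eq_iff N_def)
qed

text \<open>Polar coordinates on the 3-sphere: \<open>Re \<alpha>\<close> is the cosine of the
  angle, and \<open>Im \<alpha>\<close> together with \<open>\<beta>\<close>, normalised, is the
  axis. If the sine is zero, any unit axis serves.\<close>

lemma givens_eq_mexp:
  assumes ab: "a \<noteq> b" and unit: "\<alpha> * cnj \<alpha> + \<beta> * cnj \<beta> = 1"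
  shows "\<exists>A\<in>su. givens \<alpha> \<beta> a b = mexp A"
proof -
  have norm1: "(Re \<alpha>)\<^sup>2 + ((Im \<alpha>)\<^sup>2 + (cmod \<beta>)\<^sup>2) = 1"
  proof -
    have "of_real ((cmod \<alpha>)\<^sup>2 + (cmod \<beta>)\<^sup>2) = (1::complex)"
      using unit by (simp only: of_real_add complex_norm_square)
    then have "(cmod \<alpha>)\<^sup>2 + (cmod \<beta>)\<^sup>2 = 1" by (simp only: of_real_eq_1_iff)
    then show ?thesis by (simp add: cmod_power2)
  qed
  define s where "s = sqrt ((Im \<alpha>)\<^sup>2 + (cmod \<beta>)\<^sup>2)"
  have s2: "s\<^sup>2 = (Im \<alpha>)\<^sup>2 + (cmod \<beta>)\<^sup>2" by (simp add: s_def)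
  then have "(Re \<alpha>)\<^sup>2 + s\<^sup>2 = 1" using norm1 by simp
  then obtain t where t: "Re \<alpha> = cos t" "s = sin t" using sincos_total_2pi by metis
  obtain x z where xz: "z * cnj z + (of_real x)\<^sup>2 = (1::complex)" "Im \<alpha> = x * s" "\<beta> = z * of_real s"
  proof (cases "s = 0")
    case True
    then have "Im \<alpha> = 0" "\<beta> = 0" using s2 by (auto simp: sum_power2_eq_zero_iff)
    then show thesis using that[of 0 1] True by simp
  next
    case False
    show thesis
    proof (rule that)
      show "Im \<alpha> = (Im \<alpha> / s) * s" "\<beta> = \<beta> / of_real s * of_real s" using False by simp_all
      have "(\<beta> / of_real s) * cnj (\<beta> / of_real s) + (of_real (Im \<alpha> / s))\<^sup>2
          = of_real ((cmod (\<beta> / of_real s))\<^sup>2 + (Im \<alpha> / s)\<^sup>2)"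
        unfolding of_real_add complex_norm_square by (simp only: of_real_power)
      also have "\<dots> = of_real (((cmod \<beta>)\<^sup>2 + (Im \<alpha>)\<^sup>2) / s\<^sup>2)"
        by (simp add: norm_divide power_divide add_divide_distrib)
      also have "\<dots> = 1"
        unfolding add.commute[of "(cmod \<beta>)\<^sup>2"] s2[symmetric] using False by simp
      finally show "(\<beta> / of_real s) * cnj (\<beta> / of_real s) + (of_real (Im \<alpha> / s))\<^sup>2 = 1" .
    qed
  qed
  have "\<alpha> = of_real (cos t) + \<i> * of_real x * of_real (sin t)"
    using xz(2) t by (simp add: complex_eq_iff)
  then have "givens \<alpha> \<beta> a b = mexp (t *\<^sub>R two_level x z a b)"
    unfolding mexp_two_level[OF ab xz(1)] using xz(3) t by simp
  then show ?thesis
    using two_level_in_su[OF ab] subspace_scale[OF subspace_su] by blast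
qed

context closed_SU_monoid
begin

text \<open>Elimination as in a QR factorisation: rotations from \<open>H\<close> reduce the matrix
  column by column to the identity, and inverses in \<open>H\<close> undo them.\<close>

lemma SU_subset_if_givens:
  assumes giv: "\<And>\<alpha> \<beta> a b. a \<noteq> b \<Longrightarrow> \<alpha> * cnj \<alpha> + \<beta> * cnj \<beta> = 1 \<Longrightarrow> givens \<alpha> \<beta> a b \<in> H"
  shows "SU \<subseteq> H"
proof -
  define fixes_cols where
    "fixes_cols U J \<longleftrightarrow> (\<forall>j\<in>J. \<forall>k. U $ k $ j = (if k = j then 1 else 0))" for U :: "'n cmat" and J
  \<comment> \<open>Orthogonality of columns: a column already equal to a basis vector forces the
    matching row to vanish elsewhere, so rows in \<open>J\<close> need no elimination.\<close>
  have row: "U $ j $ a = 0" if "U \<in> SU" "fixes_cols U J" "j \<in> J" "a \<noteq> j" for U J a j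
  proof -
    have "(adjoint_mat U ** U) $ j $ a = 0"
      unfolding SU_adjoint_left[OF that(1)] using that(4) by (simp add: mat_def)
    moreover have "(adjoint_mat U ** U) $ j $ a = (\<Sum>m\<in>UNIV. if m = j then U $ j $ a else 0)"
      unfolding matrix_matrix_mult_def vec_lambda_beta
      by (rule sum.cong) (use that in \<open>auto simp: adjoint_mat_def fixes_cols_def\<close>)
    ultimately show ?thesis by simp
  qed
  have "U \<in> H" if "card (- J) = n" "U \<in> SU" "fixes_cols U J" for n J U
    using that
  proof (induction n arbitrary: J U)
    case 0
    then have "J = UNIV" by auto
    then have "U = mat 1" using 0 by (auto simp: fixes_cols_def vec_eq_iff mat_def)
    then show ?case using one by simp
  next
    case (Suc n)
    then obtain a where a: "a \<notin> J" by (metis Compl_iff card.empty ex_in_conv nat.distinct(1))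
    show ?case
    proof (cases "\<exists>b. b \<notin> J \<and> b \<noteq> a")
      case False
      then have J: "\<And>b. b \<noteq> a \<Longrightarrow> b \<in> J" by blast
      have offdiag: "U $ k $ l = 0" if "k \<noteq> l" for k l
        using row[OF Suc.prems(2,3)] J Suc.prems(3) that by (metis fixes_cols_def)
      then have "det U = (\<Prod>i\<in>UNIV. U $ i $ i)" by (rule det_diagonal)
      also have "\<dots> = (\<Prod>i\<in>UNIV. if i = a then U $ a $ a else 1)"
        by (rule prod.cong) (use J Suc.prems(3) in \<open>auto simp: fixes_cols_def\<close>)
      finally have "U $ a $ a = 1" using Suc.prems(2) by (simp add: SU_def)
      then have "U $ k $ k = 1" for k
        using J Suc.prems(3) by (cases "k = a") (auto simp: fixes_cols_def)
      then have "U = mat 1"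
        using offdiag by (simp add: vec_eq_iff mat_def)
      then show ?thesis using one by simp
    next
      case True
      then obtain b where b: "b \<notin> J" "b \<noteq> a" by blast
      have elim: "\<exists>h\<in>H. fixes_cols (h ** U) J \<and> (\<forall>c\<in>T. (h ** U) $ c $ a = 0)"
        if "finite T" "T \<subseteq> - J - {a}" for T
        using that
      proof (induction T)
        case empty
        then show ?case using one Suc.prems(3) by (intro bexI[of _ "mat 1"]) auto
      next
        case (insert c T)
        then obtain h where h: "h \<in> H" "fixes_cols (h ** U) J" "\<forall>c\<in>T. (h ** U) $ c $ a = 0" by blast
        have c: "c \<notin> J" "c \<noteq> a" "c \<notin> T" using insert by auto
        define V where "V = h ** U"
        define r where "r = sqrt ((cmod (V $ a $ a))\<^sup>2 + (cmod (V $ c $ a))\<^sup>2)"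
        show ?case
        proof (cases "r = 0")
          case True
          then have "V $ c $ a = 0" by (simp add: r_def sum_power2_eq_zero_iff)
          then show ?thesis using h by (auto simp: V_def)
        next
          case False
          \<comment> \<open>This rotation maps the pair \<open>(V $ a $ a, V $ c $ a)\<close> to
            \<open>(r, 0)\<close>.\<close>
          define G where "G = givens (cnj (V $ a $ a) / of_real r) (cnj (V $ c $ a) / of_real r) a c"
          have "of_real (r\<^sup>2) = V $ a $ a * cnj (V $ a $ a) + V $ c $ a * cnj (V $ c $ a)"
            by (simp only: complex_norm_square[symmetric] of_real_add[symmetric]) (simp add: r_def)
          then have "G \<in> H"
            unfolding G_def using False c(2)
            by (intro giv) (auto simp: power2_eq_square mult.commute simp flip: add_divide_distrib)
          moreover have "fixes_cols (G ** V) J"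
            using h(2) a c(1,2) unfolding fixes_cols_def V_def[symmetric] G_def
            by (auto simp: givens_mult_entry)
          moreover have "(G ** V) $ d $ a = 0" if "d \<in> insert c T" for d
            unfolding G_def using that h(3) c insert.prems
            by (auto simp: givens_mult_entry V_def)
          ultimately show ?thesis
            using mult[OF _ h(1)] unfolding V_def matrix_mul_assoc by blast
        qed
      qed
      obtain h where h: "h \<in> H" "fixes_cols (h ** U) J" "\<forall>c\<in>- J - {a}. (h ** U) $ c $ a = 0"
        using elim[of "- J - {a}"] by auto
      define V where "V = h ** U"
      have V: "V \<in> SU" using h(1) subset_SU Suc.prems(2) by (auto simp: V_def intro: SU_mult)
      have Va: "V $ c $ a = 0" if "c \<noteq> a" for c
        using h(3) row[OF V, of J c a] h(2) that by (cases "c \<in> J") (auto simp: V_def)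
      have unit: "cnj (V $ a $ a) * V $ a $ a = 1"
      proof -
        have "(adjoint_mat V ** V) $ a $ a = 1"
          unfolding SU_adjoint_left[OF V] by (simp add: mat_def)
        moreover have "(adjoint_mat V ** V) $ a $ a = (\<Sum>m\<in>UNIV. if m = a then cnj (V $ a $ a) * V $ a $ a else 0)"
          unfolding matrix_matrix_mult_def vec_lambda_beta
          by (rule sum.cong) (auto simp: adjoint_mat_def Va)
        ultimately show ?thesis by simp
      qed
      \<comment> \<open>Column \<open>a\<close> is now a phase times a basis vector. The phase is
        shifted to the unfinished row \<open>b\<close>; when no such \<open>b\<close> is left, the
        determinant forces it to be 1.\<close>
      define G where "G = givens (cnj (V $ a $ a)) 0 a b"
      have G: "G \<in> H" unfolding G_def using unit b(2) by (intro giv) auto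
      have "fixes_cols (G ** V) (insert a J)"
        using h(2) a b unit Va unfolding fixes_cols_def V_def[symmetric] G_def
        by (auto simp: givens_mult_entry)
      moreover have "G ** V \<in> SU" using G V subset_SU SU_mult by blast
      moreover have "card (- insert a J) = n"
      proof -
        have "- insert a J = - J - {a}" by auto
        then show ?thesis using Suc.prems(1) a by simp
      qed
      ultimately have "G ** V \<in> H" by (intro Suc.IH)
      then have "adjoint_mat (G ** h) ** (G ** V) \<in> H"
        by (rule mult[OF adjoint_in[OF mult[OF G h(1)]]])
      moreover have "adjoint_mat (G ** h) ** (G ** V) = adjoint_mat (G ** h) ** (G ** h) ** U"
        by (simp add: V_def matrix_mul_assoc)
      moreover have "G ** h \<in> SU" using G h(1) subset_SU SU_mult by blast
      ultimately show ?thesis by (simp add: SU_adjoint_left)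
    qed
  qed
  then show ?thesis by (auto simp: fixes_cols_def)
qed

lemma SU_subset_if_tangent:
  assumes "su \<subseteq> tangent" shows "SU \<subseteq> H"
proof (rule SU_subset_if_givens)
  fix \<alpha> \<beta> and a b :: 'n
  assume "a \<noteq> b" "\<alpha> * cnj \<alpha> + \<beta> * cnj \<beta> = 1"
  then obtain A where "A \<in> su" "givens \<alpha> \<beta> a b = mexp A" using givens_eq_mexp by blast
  moreover have "mexp (1 *\<^sub>R A) \<in> H" using assms \<open>A \<in> su\<close> unfolding tangent_def by blast
  ultimately show "givens \<alpha> \<beta> a b \<in> H" by simp
qed

end

section \<open>A normal direction to the special unitary group\<close>

text \<open>The orthogonal projection onto the complement of \<open>su\<close>: the Hermitian part
  plus the imaginary scalar part.\<close>

definition normal_part :: "'n::finite cmat \<Rightarrow> 'n cmat" where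
  "normal_part A = (1/2) *\<^sub>R (A + adjoint_mat A) + (Im (mtrace A) / real CARD('n)) *\<^sub>R mat \<i>"

lemma bounded_linear_normal_part: "bounded_linear (normal_part :: 'n::finite cmat \<Rightarrow> 'n cmat)"
  unfolding linear_conv_bounded_linear[symmetric]
proof (rule linearI)
  fix A B :: "'n cmat" and r :: real
  show "normal_part (A + B) = normal_part A + normal_part B"
    unfolding normal_part_def adjoint_mat_add mtrace_add
    by (simp add: add_divide_distrib scaleR_add_left scaleR_add_right)
  show "normal_part (r *\<^sub>R A) = r *\<^sub>R normal_part A"
    unfolding normal_part_def adjoint_mat_scaleR mtrace_scaleR
    by (simp add: scaleR_add_right)
qed

lemmas normal_part_diff = linear_diff[OF bounded_linear.linear[OF bounded_linear_normal_part]]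
  and normal_part_add = linear_add[OF bounded_linear.linear[OF bounded_linear_normal_part]]
  and normal_part_zero = linear_0[OF bounded_linear.linear[OF bounded_linear_normal_part]]

lemma mtrace_adjoint_mat: "mtrace (adjoint_mat A) = cnj (mtrace A)"
  by (simp add: mtrace_def adjoint_mat_def)

lemma normal_part_su: "A \<in> su \<Longrightarrow> normal_part A = 0"
  by (simp add: su_def normal_part_def)

lemma diff_normal_part_in_su: "A - normal_part A \<in> su"
  for A :: "'n::finite cmat"
proof -
  let ?J = "mat \<i> :: 'n cmat"
  have J: "adjoint_mat ?J = - ?J" by (simp add: adjoint_mat_def mat_def vec_eq_iff)
  have trJ: "mtrace ?J = of_nat CARD('n) * \<i>" by (simp add: mtrace_def mat_def)
  have "adjoint_mat (A - normal_part A) = - (A - normal_part A)"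
  proof -
    have *: "b - (X - Y) = - (a - (X + Y))" if "X + X = a + b" for a b X Y :: "'n cmat"
    proof -
      have "b = X + X - a" using that by simp
      then show ?thesis by simp
    qed
    have "(1/2) *\<^sub>R (A + adjoint_mat A) + (1/2) *\<^sub>R (A + adjoint_mat A) = A + adjoint_mat A"
      by (simp flip: scaleR_add_left)
    from *[OF this] show ?thesis
      unfolding normal_part_def adjoint_mat_diff adjoint_mat_add adjoint_mat_scaleR J
        adjoint_mat_adjoint_mat
      by (simp add: add.commute)
  qed
  moreover have "mtrace (A - normal_part A) = 0"
    unfolding normal_part_def mtrace_diff mtrace_add mtrace_scaleR trJ mtrace_adjoint_mat
    by (simp add: complex_eq_iff)
  ultimately show ?thesis by (simp add: su_def)
qed

lemma normal_part_idem: "normal_part (normal_part A) = normal_part A"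
  by (metis diff_normal_part_in_su eq_iff_diff_eq_0 normal_part_diff normal_part_su)

text \<open>With \<open>D = k - mat 1\<close>, unitarity makes the Hermitian part of
  \<open>D\<close> quadratic in \<open>D\<close>, and determinant 1 makes its trace negligible. Each
  contributes at most half of the bound.\<close>

lemma normal_part_SU_small:
  fixes \<epsilon> :: real
  assumes "\<epsilon> > 0"
  shows "\<exists>\<delta>>0. \<forall>k\<in>(SU :: 'n::finite cmat set). norm (k - mat 1) < \<delta> \<longrightarrow>
    norm (normal_part (k - mat 1)) \<le> \<epsilon> * norm (k - mat 1)"
proof -
  let ?J = "mat \<i> :: 'n cmat"
  define C where "C = norm ?J + 1"
  have C: "C > 0" by (simp add: C_def add_nonneg_pos)
  obtain K where K: "K > 0" "\<And>(A::'n cmat) (B::'n cmat). norm (A ** B) \<le> norm A * norm B * K"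
    using mm.pos_bounded by blast
  have "\<epsilon> / (2 * C) > 0" using C assms by simp
  with has_derivative_det_one[where 'n = 'n, unfolded has_derivative_at_alt]
  obtain d where d: "d > 0" "\<And>k :: 'n cmat. norm (k - mat 1) < d \<Longrightarrow>
      norm (det k - det (mat 1 :: 'n cmat) - mtrace (k - mat 1)) \<le> (\<epsilon> / (2 * C)) * norm (k - mat 1)"
    by blast
  define \<delta> where "\<delta> = min d (\<epsilon> / K)"
  have "norm (normal_part (k - mat 1)) \<le> \<epsilon> * norm (k - mat 1)"
    if k: "k \<in> SU" and small: "norm (k - mat 1) < \<delta>" for k :: "'n cmat"
  proof -
    define D where "D = k - mat 1"
    have kD: "k = mat 1 + D" by (simp add: D_def)
    have "(mat 1 + D) ** (mat 1 + adjoint_mat D) = mat 1"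
      using SU_adjoint_right[OF k] by (simp add: kD adjoint_mat_add)
    then have DD: "D + adjoint_mat D = - (D ** adjoint_mat D)"
      by (simp add: mm.add_left mm.add_right algebra_simps eq_neg_iff_add_eq_0)
    have "norm D * K \<le> \<epsilon>" using small K(1) by (simp add: \<delta>_def D_def field_simps)
    then have "norm D * norm D * K \<le> \<epsilon> * norm D"
      by (metis mult.assoc mult.commute mult_right_mono norm_ge_zero)
    then have 1: "norm ((1/2) *\<^sub>R (D + adjoint_mat D)) \<le> \<epsilon> / 2 * norm D"
      unfolding DD using K(2)[of D "adjoint_mat D"] by simp
    have tr: "norm (mtrace D) \<le> (\<epsilon> / (2 * C)) * norm D"
      using d(2)[of k] small k by (simp add: \<delta>_def D_def SU_def)
    have "\<bar>Im (mtrace D) / real CARD('n)\<bar> \<le> norm (mtrace D)"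
      using abs_Im_le_cmod[of "mtrace D"]
      by (simp add: abs_divide divide_le_eq) (smt (verit) mult_left_mono of_nat_0_less_iff
        norm_ge_zero mult_le_cancel_left1 One_nat_def Suc_leI of_nat_1 of_nat_le_iff zero_less_card_finite)
    then have "norm ((Im (mtrace D) / real CARD('n)) *\<^sub>R ?J) \<le> norm (mtrace D) * C"
      unfolding norm_scaleR real_norm_def by (intro mult_mono) (auto simp: C_def)
    also have "\<dots> \<le> (\<epsilon> / (2 * C)) * norm D * C"
      using tr C by (intro mult_right_mono) auto
    also have "\<dots> = \<epsilon> / 2 * norm D" using C by simp
    finally have 2: "norm ((Im (mtrace D) / real CARD('n)) *\<^sub>R ?J) \<le> \<epsilon> / 2 * norm D" .
    have "norm (normal_part D) \<le> \<epsilon> / 2 * norm D + \<epsilon> / 2 * norm D"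
      unfolding normal_part_def by (rule norm_triangle_mono[OF 1 2])
    then show ?thesis by (simp add: D_def)
  qed
  moreover have "\<delta> > 0" using d(1) K(1) assms by (simp add: \<delta>_def)
  ultimately show ?thesis by blast
qed

text \<open>Near the identity, \<open>SU\<close> meets each translate of the normal space at most
  once: a difference of two of its elements is almost tangent, and hence zero if it is
  normal.\<close>

lemma SU_transversal:
  "\<exists>\<delta>>0. \<forall>k\<in>(SU :: 'n::finite cmat set). \<forall>k'\<in>SU. norm (k - mat 1) < \<delta> \<longrightarrow> norm (k' - mat 1) < \<delta> \<longrightarrow>
    normal_part (k - k') = k - k' \<longrightarrow> k = k'"
proof -
  obtain K where K: "K > 0" "\<And>(A::'n cmat) (B::'n cmat). norm (A ** B) \<le> norm A * norm B * K"
    using mm.pos_bounded by blast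
  obtain M where M: "M > 0" "\<And>A :: 'n cmat. norm (normal_part A) \<le> norm A * M"
    using bounded_linear.pos_bounded[OF bounded_linear_normal_part] by blast
  obtain d where d: "d > 0" "\<And>k :: 'n cmat. k \<in> SU \<Longrightarrow> norm (k - mat 1) < d \<Longrightarrow>
      norm (normal_part (k - mat 1)) \<le> (1/4) * norm (k - mat 1)"
    using normal_part_SU_small[of "1/4"] by auto
  define \<delta> where "\<delta> = min (d / 2) (1 / (4 * K * M))"
  have "k = k'" if k: "k \<in> SU" "k' \<in> SU" and small: "norm (k - mat 1) < \<delta>" "norm (k' - mat 1) < \<delta>"
    and eq: "normal_part (k - k') = k - k'" for k k' :: "'n cmat"
  proof -
    define m where "m = k ** adjoint_mat k'"
    have m: "m \<in> SU" unfolding m_def by (intro SU_mult SU_adjoint k)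
    have kk: "k - k' = (m - mat 1) ** k'"
      unfolding m_def mm.diff_left matrix_mul_assoc[symmetric] SU_adjoint_left[OF k(2)] by simp
    have nm: "norm (k - k') = norm (m - mat 1)"
      unfolding kk by (rule norm_SU_mult_right[OF k(2)])
    have "norm (k - k') \<le> norm (k - mat 1) + norm (k' - mat 1)"
      using norm_triangle_ineq4[of "k - mat 1" "k' - mat 1"] by simp
    then have "norm (m - mat 1) < d" using small by (simp add: nm \<delta>_def)
    then have 1: "norm (normal_part (m - mat 1)) \<le> (1/4) * norm (k - k')"
      using d(2)[OF m] nm by simp
    have "norm (normal_part ((m - mat 1) ** (k' - mat 1))) \<le> norm ((m - mat 1) ** (k' - mat 1)) * M"
      by (rule M(2))
    also have "\<dots> \<le> norm (m - mat 1) * norm (k' - mat 1) * K * M"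
      using K(2) M(1) by (intro mult_right_mono) auto
    also have "\<dots> = norm (k - k') * (norm (k' - mat 1) * (K * M))"
      by (simp add: nm)
    also have "\<dots> \<le> norm (k - k') * (1/4)"
    proof (rule mult_left_mono)
      have "norm (k' - mat 1) \<le> 1 / (4 * K * M)" using small(2) by (simp add: \<delta>_def)
      then show "norm (k' - mat 1) * (K * M) \<le> 1/4"
        using K(1) M(1) by (simp add: field_simps)
    qed simp
    finally have 2: "norm (normal_part ((m - mat 1) ** (k' - mat 1))) \<le> (1/4) * norm (k - k')" by simp
    \<comment> \<open>The normal part of the first term is small because \<open>m\<close> is in
      \<open>SU\<close> near the identity, that of the second because \<open>k'\<close> is near it.
      Two quarters bound a vector by half its own norm.\<close>
    have "k - k' = (m - mat 1) + (m - mat 1) ** (k' - mat 1)"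
      unfolding kk by (simp add: mm.diff_right)
    then have "normal_part (k - k') = normal_part (m - mat 1) + normal_part ((m - mat 1) ** (k' - mat 1))"
      by (simp add: normal_part_add)
    then have "norm (k - k') \<le> (1/4) * norm (k - k') + (1/4) * norm (k - k')"
      using norm_triangle_mono[OF 1 2] eq by simp
    then show ?thesis by simp
  qed
  moreover have "\<delta> > 0" using d(1) K(1) M(1) by (simp add: \<delta>_def)
  ultimately show ?thesis by blast
qed

section \<open>Exact controllability from the rank condition\<close>

lemma exp_semigroup_mult:
  "X \<in> exp_semigroup F \<Longrightarrow> Y \<in> exp_semigroup F \<Longrightarrow> X ** Y \<in> exp_semigroup F"
  by (induction X rule: exp_semigroup.induct)
    (auto simp: matrix_mul_assoc[symmetric] intro: exp_semigroup.step)

lemma mexp_in_exp_semigroup: "Z \<in> F \<Longrightarrow> 0 \<le> t \<Longrightarrow> mexp (t *\<^sub>R Z) \<in> exp_semigroup F"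
  using exp_semigroup.step[OF exp_semigroup.one, of Z F t] by simp

section \<open>The semigroup of a generating family: density, directions, interior\<close>

locale rank_condition =
  fixes F :: "'n::finite cmat set"
  assumes F_su: "F \<subseteq> su"
    and generates: "lie_algebra L \<Longrightarrow> F \<subseteq> L \<Longrightarrow> su \<subseteq> L"
begin

abbreviation S :: "'n cmat set" where "S \<equiv> exp_semigroup F"

lemma S_SU: "S \<subseteq> SU"
proof
  fix X assume "X \<in> S"
  then show "X \<in> SU"
  proof induction
    case (step Y Z t)
    then have "t *\<^sub>R Z \<in> su" using F_su subspace_scale[OF subspace_su] by blast
    then show ?case using step by (intro SU_mult mexp_in_SU)
  qed simp
qed

lemma dense: "SU \<subseteq> closure S"
proof -
  interpret closed_SU_monoid "closure S"
  proof
    show "closed (closure S)" by simp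
    show "closure S \<subseteq> SU" using S_SU closed_SU by (rule closure_minimal)
    show "mat 1 \<in> closure S" using exp_semigroup.one closure_subset by blast
    fix X Y assume "X \<in> closure S" "Y \<in> closure S"
    then obtain x y where "\<And>n. x n \<in> S" "x \<longlonglongrightarrow> X" "\<And>n. y n \<in> S" "y \<longlonglongrightarrow> Y"
      unfolding closure_sequential by blast
    then show "X ** Y \<in> closure S"
      unfolding closure_sequential
      by (intro exI[of _ "\<lambda>n. x n ** y n"] conjI allI exp_semigroup_mult mm.tendsto)
  qed
  have pos: "mexp (t *\<^sub>R Z) \<in> closure S" if "Z \<in> F" "t \<ge> 0" for Z t
    using mexp_in_exp_semigroup[OF that] closure_subset by blast
  have "Z \<in> tangent" if Z: "Z \<in> F" for Z
  proof -
    have su: "Z \<in> su" using Z F_su by blast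
    have "mexp (t *\<^sub>R Z) \<in> closure S" for t
    proof (cases "t \<ge> 0")
      case False
      have "(- t) *\<^sub>R Z \<in> su" by (rule subspace_scale[OF subspace_su su])
      then have "mexp (t *\<^sub>R Z) = adjoint_mat (mexp ((- t) *\<^sub>R Z))"
        using mexp_minus_adjoint[of "(- t) *\<^sub>R Z"] by simp
      then show ?thesis using adjoint_in[OF pos[OF Z, of "- t"]] False by simp
    qed (use pos Z in auto)
    then show ?thesis using su by (simp add: tangent_def)
  qed
  then have "su \<subseteq> tangent" by (intro generates lie_algebra_tangent) auto
  then show ?thesis by (rule SU_subset_if_tangent)
qed

text \<open>The span is visibly invariant only under conjugation by the semigroup. Density and
  closedness extend this to all of \<open>SU\<close>; differentiating along exponentials then makes
  the span a Lie algebra.\<close>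

lemma su_subset_span: "su \<subseteq> span {s ** Z ** adjoint_mat s | s Z. s \<in> S \<and> Z \<in> F}"
  (is "_ \<subseteq> span ?G")
proof (rule generates)
  let ?V = "span ?G"
  have lin: "linear (\<lambda>Y. U ** Y ** adjoint_mat U)" for U :: "'n cmat"
    by (rule linearI) (simp_all add: mm.add_left mm.add_right mm.scaleR_left mm.scaleR_right)
  have Vsu: "?V \<subseteq> su"
    using F_su S_SU by (intro span_minimal subspace_su) (auto intro!: su_conj)
  have inv: "u ** Y ** adjoint_mat u \<in> ?V" if "u \<in> S" "Y \<in> ?V" for u Y
  proof -
    have "(\<lambda>Y. u ** Y ** adjoint_mat u) ` ?G \<subseteq> ?G"
    proof clarify
      fix s Z assume "s \<in> S" "Z \<in> F"
      then show "\<exists>s' Z'. u ** (s ** Z ** adjoint_mat s) ** adjoint_mat u = s' ** Z' ** adjoint_mat s'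
          \<and> s' \<in> S \<and> Z' \<in> F"
        using exp_semigroup_mult[OF that(1)]
        by (intro exI[of _ "u ** s"] exI[of _ Z]) (simp add: adjoint_mat_mult matrix_mul_assoc)
    qed
    then show ?thesis
      using linear_span_image[OF lin, of u ?G] span_mono that(2) by blast
  qed
  have inv': "U ** Y ** adjoint_mat U \<in> ?V" if "U \<in> SU" "Y \<in> ?V" for U Y
  proof -
    have "U \<in> closure S" using dense that(1) by blast
    then obtain u where u: "\<And>n. u n \<in> S" "u \<longlonglongrightarrow> U"
      unfolding closure_sequential by blast
    have "(\<lambda>n. u n ** Y ** adjoint_mat (u n)) \<longlonglongrightarrow> U ** Y ** adjoint_mat U"
      by (intro mm.tendsto bounded_linear.tendsto[OF bounded_linear_adjoint_mat] u tendsto_const)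
    then show ?thesis
      by (rule closed_sequentially[OF closed_subspace[OF subspace_span], rotated]) (intro inv u that(2))
  qed
  show "lie_algebra ?V"
  proof
    fix X Y assume X: "X \<in> ?V" and Y: "Y \<in> ?V"
    show "commutator X Y \<in> ?V"
    proof (rule commutator_in_subspace[OF subspace_span])
      fix t
      have "t *\<^sub>R X \<in> su" using X Vsu subspace_scale[OF subspace_su] by blast
      then show "mexp (t *\<^sub>R X) ** Y ** mexp (t *\<^sub>R (- X)) \<in> ?V"
        using inv'[OF mexp_in_SU Y, of "t *\<^sub>R X"] mexp_minus_adjoint[of "t *\<^sub>R X"] by simp
    qed
  qed simp
  show "F \<subseteq> ?V"
  proof
    fix Z assume "Z \<in> F"
    then have "Z \<in> ?G"
      using exp_semigroup.one[of F] by (intro CollectI exI[of _ "mat 1"] exI[of _ Z]) simp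
    then show "Z \<in> ?V" by (rule span_base)
  qed
qed

lemma new_direction:
  assumes W: "subspace W" "\<not> su \<subseteq> W" and r: "r \<in> SU"
  shows "\<exists>s\<in>S. \<exists>Z\<in>F. (r ** s) ** Z ** adjoint_mat (r ** s) \<notin> W"
proof (rule ccontr)
  assume neg: "\<not> ?thesis"
  have lin: "linear (\<lambda>Y. r ** Y ** adjoint_mat r)"
    by (rule linearI) (simp_all add: mm.add_left mm.add_right mm.scaleR_left mm.scaleR_right)
  have "span {s ** Z ** adjoint_mat s | s Z. s \<in> S \<and> Z \<in> F} \<subseteq> (\<lambda>Y. r ** Y ** adjoint_mat r) -` W"
    using neg by (intro span_minimal linear_subspace_vimage[OF lin W(1)])
      (auto simp: adjoint_mat_mult matrix_mul_assoc)
  then have *: "r ** Y ** adjoint_mat r \<in> W" if "Y \<in> su" for Y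
    using su_subset_span that by blast
  have "A \<in> W" if "A \<in> su" for A
  proof -
    have "r ** (adjoint_mat r ** A ** r) ** adjoint_mat r = (r ** adjoint_mat r) ** A ** (r ** adjoint_mat r)"
      by (simp only: matrix_mul_assoc)
    then show ?thesis
      using *[OF su_conj[OF SU_adjoint[OF r] that]] by (simp add: SU_adjoint_right[OF r])
  qed
  then show False using W(2) by blast
qed

text \<open>The parameter space is always the full matrix space, so that adding an exponential
  changes no types. \<open>T\<close> is the differential at 0, translated from \<open>f 0\<close>
  back to the identity.\<close>

definition chart :: "('n cmat \<Rightarrow> 'n cmat) \<Rightarrow> ('n cmat \<Rightarrow> 'n cmat) \<Rightarrow> bool" where
  "chart f T \<longleftrightarrow> continuous_on UNIV f \<and> (\<forall>Y. norm Y < 1 \<longrightarrow> f Y \<in> S) \<and> linear T \<and> range T \<subseteq> su \<and>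
     (f has_derivative (\<lambda>Y. T Y ** f 0)) (at 0)"

lemma chart_extend:
  assumes ch: "chart f T" and not: "\<not> su \<subseteq> range T"
  shows "\<exists>g T'. chart g T' \<and> dim (range T') \<ge> Suc (dim (range T))"
proof -
  have cont: "continuous_on UNIV f" and fS: "\<And>Y. norm Y < 1 \<Longrightarrow> f Y \<in> S" and lin: "linear T"
    and ran: "range T \<subseteq> su" and der: "(f has_derivative (\<lambda>Y. T Y ** f 0)) (at 0)"
    using ch by (auto simp: chart_def)
  have sub: "subspace (range T)" using linear_subspace_image[OF lin subspace_UNIV] .
  have f0: "f 0 \<in> SU" using fS[of 0] S_SU by auto
  obtain s Z where sZ: "s \<in> S" "Z \<in> F" and new: "(f 0 ** s) ** Z ** adjoint_mat (f 0 ** s) \<notin> range T"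
    using new_direction[OF sub not f0] by blast
  define v where "v = (f 0 ** s) ** Z ** adjoint_mat (f 0 ** s)"
  have fs: "f 0 ** s \<in> SU" using f0 sZ(1) S_SU SU_mult by blast
  have v: "v \<in> su" unfolding v_def using F_su sZ(2) by (intro su_conj fs) auto
  \<comment> \<open>Domain and codomain have equal dimension, so a missed direction leaves an idle
    parameter \<open>u\<close> to drive the new exponential.\<close>
  have "\<not> inj T" using linear_inj_imp_surj[OF lin] not by auto
  then obtain u' where u': "u' \<noteq> 0" "T u' = 0"
    unfolding linear_injective_0[OF lin] by blast
  define u where "u = u' /\<^sub>R norm u'"
  have u: "norm u = 1" "T u = 0" using u' by (simp_all add: u_def linear_scale[OF lin])
  have uu: "u \<bullet> u = 1" using u(1) by (simp add: norm_eq_1)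
  \<comment> \<open>The offset 1 keeps the time nonnegative on the unit ball while it varies in both
    directions around 1.\<close>
  define g where "g Y = f Y ** s ** mexp ((1 + u \<bullet> Y) *\<^sub>R Z)" for Y
  define T' where "T' Y = T Y + (u \<bullet> Y) *\<^sub>R v" for Y
  have g0: "g 0 = f 0 ** s ** mexp Z" by (simp add: g_def)
  have "continuous_on UNIV g"
    unfolding g_def
    by (intro mm.continuous_on cont continuous_on_const
        continuous_on_compose2[OF continuous_on_mexp[of UNIV]] continuous_intros) auto
  moreover have "g Y \<in> S" if "norm Y < 1" for Y
  proof -
    have "\<bar>u \<bullet> Y\<bar> \<le> 1" using Cauchy_Schwarz_ineq2[of u Y] u(1) that by simp
    then show ?thesis
      unfolding g_def by (intro exp_semigroup_mult fS that sZ mexp_in_exp_semigroup) simp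
  qed
  moreover have "linear T'"
    unfolding T'_def
    by (rule linearI) (simp_all add: linear_add[OF lin] linear_scale[OF lin] inner_add_right algebra_simps)
  moreover have "range T' \<subseteq> su"
    using ran v by (auto simp: T'_def intro!: subspace_add[OF subspace_su] subspace_scale[OF subspace_su])
  moreover have "(g has_derivative (\<lambda>Y. T' Y ** g 0)) (at 0)"
  proof -
    have "((\<lambda>Y. 1 + u \<bullet> Y) has_derivative (\<lambda>Y. u \<bullet> Y)) (at 0)"
      by (auto intro!: derivative_eq_intros)
    moreover have "((\<lambda>t. mexp (t *\<^sub>R Z)) has_derivative (\<lambda>h. h *\<^sub>R (Z ** mexp Z))) (at (1 + u \<bullet> 0))"
      using mexp_has_vector_derivative[of Z 1] by (simp add: has_vector_derivative_def)
    ultimately have k: "((\<lambda>Y. mexp ((1 + u \<bullet> Y) *\<^sub>R Z)) has_derivative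
        (\<lambda>Y. (u \<bullet> Y) *\<^sub>R (Z ** mexp Z))) (at 0)"
      by (rule has_derivative_compose)
    have "((\<lambda>Y. f Y ** s) has_derivative (\<lambda>Y. T Y ** f 0 ** s)) (at 0)"
      by (rule bounded_linear.has_derivative[OF mm.bounded_linear_left der])
    from mm.FDERIV[OF this k]
    have "(g has_derivative (\<lambda>Y. f 0 ** s ** ((u \<bullet> Y) *\<^sub>R (Z ** mexp Z)) + T Y ** f 0 ** s ** mexp Z)) (at 0)"
      by (simp add: g_def[abs_def])
    moreover have "f 0 ** s ** ((u \<bullet> Y) *\<^sub>R (Z ** mexp Z)) + T Y ** f 0 ** s ** mexp Z = T' Y ** g 0" for Y
    proof -
      have "v ** g 0 = f 0 ** s ** Z ** (adjoint_mat (f 0 ** s) ** (f 0 ** s)) ** mexp Z"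
        unfolding v_def g0 by (simp only: matrix_mul_assoc)
      then have "v ** g 0 = f 0 ** s ** (Z ** mexp Z)"
        unfolding SU_adjoint_left[OF fs] by (simp add: matrix_mul_assoc)
      then show ?thesis
        unfolding T'_def mm.add_left mm.scaleR_left mm.scaleR_right
        by (simp add: g0 matrix_mul_assoc)
    qed
    ultimately show ?thesis by simp
  qed
  ultimately have "chart g T'" unfolding chart_def by blast
  moreover have "dim (range T') \<ge> Suc (dim (range T))"
  proof -
    \<comment> \<open>Since \<open>T u = 0\<close>, removing the \<open>u\<close> component loses
      nothing of the old range, and \<open>u\<close> itself yields \<open>v\<close>.\<close>
    have "T Y = T' (Y - (u \<bullet> Y) *\<^sub>R u)" for Y
      by (simp add: T'_def linear_diff[OF lin] linear_scale[OF lin] u(2) inner_diff_right uu)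
    moreover have "v = T' u" by (simp add: T'_def u(2) uu)
    ultimately have "insert v (range T) \<subseteq> range T'" by (metis (no_types, lifting) image_subset_iff insert_subset rangeI)
    then have "dim (insert v (range T)) \<le> dim (range T')" by (rule dim_subset)
    moreover have "v \<notin> span (range T)" using new sub by (simp add: v_def span_eq_iff[THEN iffD2])
    ultimately show ?thesis by (simp add: dim_insert)
  qed
  ultimately show ?thesis by blast
qed

lemma chart_exists: "\<exists>f T. chart f T \<and> range T = su"
proof -
  have "\<exists>f T. chart f T \<and> (dim (range T) \<ge> d \<or> su \<subseteq> range T)" for d
  proof (induction d)
    case 0
    have "chart (\<lambda>Y. mat 1) (\<lambda>Y. 0)"
      using exp_semigroup.one subspace_0[OF subspace_su]
      by (auto simp: chart_def linear_zero continuous_on_const)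
    then show ?case by blast
  next
    case (Suc d)
    then obtain f T where fT: "chart f T" "dim (range T) \<ge> d \<or> su \<subseteq> range T" by blast
    show ?case
    proof (cases "su \<subseteq> range T")
      case True
      then show ?thesis using fT by blast
    next
      case False
      then show ?thesis using chart_extend[OF fT(1) False] fT(2) by (meson Suc_le_mono le_trans)
    qed
  qed
  \<comment> \<open>A rank beyond the dimension of \<open>su\<close> is impossible, which leaves the
    other alternative.\<close>
  from this[of "Suc (dim (su :: 'n cmat set))"]
  obtain f T where fT: "chart f T" "dim (range T) \<ge> Suc (dim (su :: 'n cmat set)) \<or> su \<subseteq> range T" by blast
  then have "range T \<subseteq> su" by (simp add: chart_def)
  moreover have "dim (range T) \<le> dim (su :: 'n cmat set)" using calculation by (rule dim_subset)
  ultimately have "range T = su" using fT(2) by auto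
  then show ?thesis using fT(1) by blast
qed

lemma SU_neighbourhood: "\<exists>f0\<in>S. \<exists>\<epsilon>>0. \<forall>g\<in>SU. norm (g - f0) < \<epsilon> \<longrightarrow> g \<in> S"
proof -
  obtain f T where ch: "chart f T" and ran: "range T = su" using chart_exists by blast
  have cont: "continuous_on UNIV f" and fS: "\<And>Y. norm Y < 1 \<Longrightarrow> f Y \<in> S" and lin: "linear T"
    and der: "(f has_derivative (\<lambda>Y. T Y ** f 0)) (at 0)"
    using ch by (auto simp: chart_def)
  have f0S: "f 0 \<in> S" using fS[of 0] by simp
  then have f0: "f 0 \<in> SU" using S_SU by blast
  obtain G where G: "linear G" "\<And>A. A \<in> su \<Longrightarrow> T (G A) = A"
    using linear_exists_right_inverse_on[OF lin subspace_UNIV] ran by auto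
  obtain \<delta> where \<delta>: "\<delta> > 0" "\<And>k k' :: 'n cmat. k \<in> SU \<Longrightarrow> k' \<in> SU \<Longrightarrow> norm (k - mat 1) < \<delta> \<Longrightarrow>
      norm (k' - mat 1) < \<delta> \<Longrightarrow> normal_part (k - k') = k - k' \<Longrightarrow> k = k'"
    using SU_transversal[where 'n = 'n] by blast
  define q where "q Y = G (Y - normal_part Y)" for Y
  have blq: "bounded_linear q"
    unfolding q_def
    by (intro bounded_linear_compose[OF linear_conv_bounded_linear[THEN iffD1, OF G(1)]]
        bounded_linear_sub bounded_linear_ident bounded_linear_normal_part)
  have q0: "q 0 = 0" using linear_0[OF bounded_linear.linear[OF blq]] .
  have contq: "continuous_on UNIV q" by (rule linear_continuous_on[OF blq])
  have contfq: "continuous_on UNIV (\<lambda>Y. f (q Y))"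
    by (rule continuous_on_compose2[OF cont contq]) auto
  \<comment> \<open>\<open>q\<close> feeds the tangential part of \<open>Y\<close> through a right
    inverse of \<open>T\<close>, and the normal part is added by hand. The derivative at 0 becomes
    right multiplication by \<open>f 0\<close>, which is invertible.\<close>
  define \<Phi> where "\<Phi> Y = f (q Y) + normal_part Y ** f 0" for Y
  define N where "N = {Y. norm (q Y) < 1} \<inter> {Y. norm (f (q Y) - f 0) < \<delta>}"
  have "open N"
    unfolding N_def by (intro open_Int open_Collect_less continuous_intros contq contfq)
  \<comment> \<open>This open mapping theorem asks for continuity and an invertible derivative at a
    single point, exactly what a chart supplies.\<close>
  have "\<Phi> 0 \<in> interior (\<Phi> ` N)"
  proof (rule sussmann_open_mapping[of UNIV _ _ "\<lambda>Y. Y ** f 0" "\<lambda>Y. Y ** adjoint_mat (f 0)"])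
    show "continuous_on UNIV \<Phi>"
      unfolding \<Phi>_def
      by (intro continuous_on_add contfq mm.continuous_on continuous_on_const
          linear_continuous_on bounded_linear_normal_part)
    have "((\<lambda>Y. f (q Y)) has_derivative (\<lambda>Y. T (q Y) ** f 0)) (at 0)"
      by (rule has_derivative_compose[OF bounded_linear_imp_has_derivative[OF blq]]) (simp add: q0 der)
    then have "(\<Phi> has_derivative (\<lambda>Y. T (q Y) ** f 0 + normal_part Y ** f 0)) (at 0)"
      unfolding \<Phi>_def
      by (intro has_derivative_add bounded_linear_imp_has_derivative
          bounded_linear_compose[OF mm.bounded_linear_left bounded_linear_normal_part])
    moreover have "T (q Y) ** f 0 + normal_part Y ** f 0 = Y ** f 0" for Y
      unfolding q_def G(2)[OF diff_normal_part_in_su] by (simp flip: mm.add_left)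
    ultimately show "(\<Phi> has_derivative (\<lambda>Y. Y ** f 0)) (at 0)" by simp
    show "(\<lambda>Y. Y ** f 0) \<circ> (\<lambda>Y. Y ** adjoint_mat (f 0)) = id"
      by (simp add: fun_eq_iff matrix_mul_assoc[symmetric] SU_adjoint_left[OF f0])
    show "0 \<in> interior N"
      unfolding interior_open[OF \<open>open N\<close>] using \<delta>(1) by (simp add: N_def q0)
  qed (auto intro: mm.bounded_linear_left)
  moreover have "\<Phi> 0 = f 0" by (simp add: \<Phi>_def q0 normal_part_zero)
  ultimately obtain \<epsilon> where \<epsilon>: "\<epsilon> > 0" "ball (f 0) \<epsilon> \<subseteq> \<Phi> ` N"
    unfolding mem_interior by auto
  have "g \<in> S" if g: "g \<in> SU" "norm (g - f 0) < min \<epsilon> \<delta>" for g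
  proof -
    have "g \<in> ball (f 0) \<epsilon>" using g(2) by (simp add: dist_norm norm_minus_commute)
    then obtain Y where Y: "Y \<in> N" "g = \<Phi> Y" using \<epsilon>(2) by blast
    have FS: "f (q Y) \<in> S" using Y(1) by (intro fS) (simp add: N_def)
    define k where "k = g ** adjoint_mat (f 0)"
    define k' where "k' = f (q Y) ** adjoint_mat (f 0)"
    have near: "norm (x ** adjoint_mat (f 0) - mat 1) = norm (x - f 0)" for x
      using norm_SU_mult_right[OF SU_adjoint[OF f0], of "x - f 0"]
      by (simp add: mm.diff_left SU_adjoint_right[OF f0])
    \<comment> \<open>After translation to the identity, \<open>g\<close> and \<open>f (q Y)\<close>
      differ by a normal vector, so transversality identifies them.\<close>
    have "k - k' = normal_part Y"
      unfolding k_def k'_def mm.diff_left[symmetric] Y(2) \<Phi>_def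
      by (simp add: matrix_mul_assoc[symmetric] SU_adjoint_right[OF f0])
    then have "normal_part (k - k') = k - k'" by (simp add: normal_part_idem)
    moreover have "k \<in> SU" "k' \<in> SU"
      unfolding k_def k'_def using g(1) FS S_SU f0 by (auto intro!: SU_mult SU_adjoint)
    moreover have "norm (k - mat 1) < \<delta>" "norm (k' - mat 1) < \<delta>"
      unfolding k_def k'_def near using g(2) Y(1) by (simp_all add: N_def)
    ultimately have "k = k'" by (rule \<delta>(2)[rotated 4])
    then have "k ** f 0 = k' ** f 0" by simp
    then have "g = f (q Y)"
      unfolding k_def k'_def by (simp add: matrix_mul_assoc[symmetric] SU_adjoint_left[OF f0])
    then show ?thesis using FS by simp
  qed
  then show ?thesis using f0S \<epsilon>(1) \<delta>(1) by (intro bexI[of _ "f 0"] exI[of _ "min \<epsilon> \<delta>"]) auto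
qed

text \<open>Density provides \<open>s\<close> in the semigroup near
  \<open>U ** adjoint_mat f0\<close>; then \<open>adjoint_mat s ** U\<close> is near the interior
  point \<open>f0\<close>, hence in the semigroup, and \<open>U\<close> is a product of two of its
  elements.\<close>

theorem SU_subset_exp_semigroup: "SU \<subseteq> S"
proof
  fix U :: "'n cmat"
  assume U: "U \<in> SU"
  obtain f0 \<epsilon> where f0: "f0 \<in> S" "\<epsilon> > 0" "\<And>g. g \<in> SU \<Longrightarrow> norm (g - f0) < \<epsilon> \<Longrightarrow> g \<in> S"
    using SU_neighbourhood by blast
  have f0SU: "f0 \<in> SU" using f0(1) S_SU by blast
  have "U ** adjoint_mat f0 \<in> closure S"
    using dense U f0SU SU_mult SU_adjoint by blast
  then obtain s where s: "s \<in> S" "dist s (U ** adjoint_mat f0) < \<epsilon>"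
    using f0(2) unfolding closure_approachable by blast
  have sSU: "s \<in> SU" using s(1) S_SU by blast
  have "s ** (adjoint_mat s ** U - f0) ** adjoint_mat f0 = U ** adjoint_mat f0 - s"
    by (simp add: mm.diff_left mm.diff_right matrix_mul_assoc SU_adjoint_right[OF sSU])
      (simp add: matrix_mul_assoc[symmetric] SU_adjoint_right[OF f0SU])
  then have "norm (adjoint_mat s ** U - f0) = norm (U ** adjoint_mat f0 - s)"
    using norm_SU_mult_right[OF SU_adjoint[OF f0SU]] norm_SU_mult_left[OF sSU] by metis
  then have "adjoint_mat s ** U \<in> S"
    using s(2) U sSU by (intro f0(3) SU_mult SU_adjoint) (simp_all add: dist_norm norm_minus_commute)
  then have "s ** (adjoint_mat s ** U) \<in> S" by (rule exp_semigroup_mult[OF s(1)])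
  then show "U \<in> S" by (simp add: matrix_mul_assoc SU_adjoint_right[OF sSU])
qed

end

section \<open>Structural controllability\<close>

lemma skew_unit_in_su: "a \<noteq> b \<Longrightarrow> skew_unit z a b \<in> su"
proof -
  assume ab: "a \<noteq> b"
  have "skew_unit z a b = two_level 0 z a b"
    using ab by (auto simp: vec_eq_iff skew_unit_entry two_level_def)
  then show ?thesis using two_level_in_su[OF ab] by simp
qed

lemma Dmat_in_su: "a \<noteq> b \<Longrightarrow> Dmat a b \<in> su"
proof -
  assume ab: "a \<noteq> b"
  have "Dmat a b = two_level 1 0 a b"
    using ab by (auto simp: vec_eq_iff Dmat_entry two_level_def)
  then show ?thesis using two_level_in_su[OF ab] by simp
qed

lemma zero_in_Sigma_f: "0 \<in> Sigma_f G"
  unfolding Sigma_f_def by (intro CollectI exI[of _ "\<lambda>_. 0"]) simp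

lemma in_Sigma_f:
  assumes "finite G" "g \<in> G" shows "g \<in> Sigma_f G"
proof -
  have "(\<Sum>h\<in>G. (if h = g then 1 else 0) *\<^sub>R h) = (\<Sum>h\<in>G. if h = g then g else 0)"
    by (rule sum.cong) auto
  also have "\<dots> = g" using assms by simp
  finally show ?thesis
    unfolding Sigma_f_def by (intro CollectI exI[of _ "\<lambda>h. if h = g then 1 else 0"]) simp
qed

lemma velocities_subset_iff:
  assumes L: "subspace L"
  shows "velocities B0 Bs \<subseteq> L \<longleftrightarrow> B0 \<in> L \<and> set Bs \<subseteq> L"
proof
  assume vel: "velocities B0 Bs \<subseteq> L"
  have in_L: "B0 + (\<Sum>i<length Bs. c i *\<^sub>R Bs ! i) \<in> L" for c
    using vel unfolding velocities_def by blast
  have B0: "B0 \<in> L" using in_L[of "\<lambda>_. 0"] by simp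
  have "Bs ! j \<in> L" if "j < length Bs" for j
  proof -
    have "(\<Sum>i<length Bs. (if i = j then 1 else 0) *\<^sub>R Bs ! i) = (\<Sum>i<length Bs. if i = j then Bs ! j else 0)"
      by (rule sum.cong) auto
    also have "\<dots> = Bs ! j" using that by simp
    finally have "B0 + Bs ! j \<in> L" using in_L[of "\<lambda>i. if i = j then 1 else 0"] by simp
    from subspace_diff[OF L this B0] show ?thesis by simp
  qed
  then show "B0 \<in> L \<and> set Bs \<subseteq> L" using B0 by (auto simp: in_set_conv_nth)
next
  assume "B0 \<in> L \<and> set Bs \<subseteq> L"
  then show "velocities B0 Bs \<subseteq> L"
    unfolding velocities_def
    by (auto intro!: subspace_add[OF L] subspace_sum[OF L] subspace_scale[OF L])
qed

theorem theorem5: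
  fixes As S1 S2 S3 :: "('n::{finite,linorder}) cmat set"
  assumes n2: "CARD('n) \<ge> 2"
    and As_fin: "finite As" and As_su: "As \<subseteq> su"
    and S1: "S1 \<subseteq> {Bmat i j | i j. i < j}"
    and S2: "S2 \<subseteq> {Cmat i j | i j. i < j}"
    and S3: "S3 \<subseteq> {Dmat i j | i j. i < j}"
    and not_conn: "\<not> graph_connected (contr_edges S1 S2 S3)"
    and i: "\<forall>K\<in>components (contr_edges S1 S2 S3). card K \<ge> 3"
    and ii: "\<not> has_multi_edge (drift_edges As)"
       "graph_connected (drift_edges As \<union> contr_edges S1 S2 S3)"
    and iii: "has_self_loop (drift_edges As \<union> contr_edges S1 S2 S3) \<or>
       (\<exists>w. is_cycle (drift_edges As \<union> contr_edges S1 S2 S3) w \<and> odd (num_red w))"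
  shows "structurally_controllable As (S1 \<union> S2 \<union> S3)"
proof -
  let ?G = "S1 \<union> S2 \<union> S3"
  have "?G \<subseteq> (\<lambda>(i, j). Bmat i j) ` UNIV \<union> (\<lambda>(i, j). Cmat i j) ` UNIV \<union> (\<lambda>(i, j). Dmat i j) ` UNIV"
    using S1 S2 S3 by fastforce
  then have fin: "finite ?G" by (rule finite_subset) simp
  have G_su: "?G \<subseteq> su"
  proof -
    have "Bmat i j \<in> su" "Cmat i j \<in> su" "Dmat i j \<in> su" if "i < j" for i j :: 'n
      using that skew_unit_in_su[of i j] Dmat_in_su[of i j]
      by (auto simp: Bmat_eq_skew_unit Cmat_eq_skew_unit)
    then show ?thesis using S1 S2 S3 by blast
  qed
  obtain l where l: "\<forall>A\<in>As. l A \<noteq> 0"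
    "\<And>a b. \<exists>A\<in>As. A $ a $ b \<noteq> 0 \<Longrightarrow> (\<Sum>A\<in>As. l A *\<^sub>R A) $ a $ b \<noteq> 0"
    using generic_combination[OF As_fin] by blast
  define B0 where "B0 = (\<Sum>A\<in>As. l A *\<^sub>R A)"
  obtain xs where xs: "set xs = ?G" using finite_list[OF fin] by blast
  \<comment> \<open>The zero matrix in front makes the required length immediate and contributes
    nothing to the dynamics.\<close>
  define Bs where "Bs = 0 # xs"
  have "B0 \<in> su"
    unfolding B0_def using As_su by (intro subspace_sum[OF subspace_su] subspace_scale[OF subspace_su]) auto
  moreover have "set Bs \<subseteq> su"
    using G_su subspace_0[OF subspace_su] by (simp add: Bs_def xs)
  ultimately have vel_su: "velocities B0 Bs \<subseteq> su"
    by (simp add: velocities_subset_iff[OF subspace_su])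
  interpret rank_condition "velocities B0 Bs"
  proof
    show "velocities B0 Bs \<subseteq> su" by (rule vel_su)
    fix L :: "'n cmat set"
    assume L: "lie_algebra L" and "velocities B0 Bs \<subseteq> L"
    then have "B0 \<in> L" "?G \<subseteq> L"
      by (auto simp: velocities_subset_iff[OF lie_algebra.subspace[OF L]] Bs_def xs)
    then show "su \<subseteq> L"
      unfolding B0_def using su_subset_lie_algebra[OF L _ _ As_su l(2) i ii iii] by blast
  qed
  have "controllable B0 Bs"
    unfolding controllable_def using SU_subset_exp_semigroup exp_semigroup_reachable by blast
  moreover have "B0 \<in> Sigma_r As"
    unfolding Sigma_r_def B0_def using l(1) by blast
  moreover have "set Bs \<subseteq> Sigma_f ?G"
    using in_Sigma_f[OF fin] zero_in_Sigma_f by (auto simp: Bs_def xs)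
  moreover have "length Bs \<ge> 1" by (simp add: Bs_def)
  ultimately show ?thesis unfolding structurally_controllable_def by blast
qed

end
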